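(* (i) The monoid $\widetilde B_\bullet^+$ embeds in the group $\widetilde B_\bullet$ (via the canonical map), and $\widetilde B_\bullet$ is a group of left fractions of $\widetilde B_\bullet^+$, i.e., every element of $\widetilde B_\bullet$ can be expressed as $x^{-1}y$ with $x,y\in\widetilde B_\bullet^+$. Moreover, every element of $\widetilde B_\bullet$ can be expressed as $f^{-1}\beta^{-1}\gamma g$ with $\beta,\gamma\in B_\infty^+$ and $f,g\in F^+$. (ii) The group $\widetilde B_\bullet$ is torsion free.
   Context: $R_\bullet$ denotes the following family of relations between letters $\sigma_i,a_i$ ($i\ge1$), for all $i\ge1$ and $j\ge i+2$: $\sigma_i\sigma_j=\sigma_j\sigma_i$, $\sigma_ia_j=a_j\sigma_i$, $a_ia_{j-1}=a_ja_i$, $a_i\sigma_{j-1}=\sigma_ja_i$, $\sigma_i\sigma_{i+1}\sigma_i=\sigma_{i+1}\sigma_i\sigma_{i+1}$, $\sigma_{i+1}\sigma_ia_{i+1}=a_i\sigma_i$, $\sigma_i\sigma_{i+1}a_i=a_{i+1}\sigma_i$. $\widetilde B_\bullet$ is the group, and $\widetilde B_\bullet^+$ the monoid, presented by the generators $\sigma_i,a_i$ ($i\ge1$) and the relations $R_\bullet$. $B_\infty^+$ (the braid monoid) and $F^+$ (Thompson's monoid) denote the submonoids of $\widetilde B_\bullet^+$ generated by all $\sigma_i$'s and by all $a_i$'s respectively. *)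

theory Defs
  imports "HOL-Algebra.Group"
begin

inductive_set presented_cong :: "'x set \<Rightarrow> ('x list \<times> 'x list) set \<Rightarrow> ('x list \<times> 'x list) set"
  for X :: "'x set" and R :: "('x list \<times> 'x list) set"
  where
    refl: "w \<in> lists X \<Longrightarrow> (w, w) \<in> presented_cong X R"
  | step: "\<lbrakk>(l, r) \<in> R; u @ l @ v \<in> lists X; u @ r @ v \<in> lists X\<rbrakk>
      \<Longrightarrow> (u @ l @ v, u @ r @ v) \<in> presented_cong X R"
  | sym: "(v, w) \<in> presented_cong X R \<Longrightarrow> (w, v) \<in> presented_cong X R"
  | trans: "\<lbrakk>(u, v) \<in> presented_cong X R; (v, w) \<in> presented_cong X R\<rbrakk>
      \<Longrightarrow> (u, w) \<in> presented_cong X R"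

definition presented_monoid ::
    "'x set \<Rightarrow> ('x list \<times> 'x list) set \<Rightarrow> 'x list set monoid"
  where "presented_monoid X R =
    \<lparr>carrier = lists X // presented_cong X R,
     mult = (\<lambda>C D. \<Union>u\<in>C. \<Union>v\<in>D. presented_cong X R `` {u @ v}),
     one = presented_cong X R `` {[]}\<rparr>"

text \<open>In a signed word, the letter \<open>(True, x)\<close> stands for \<open>x\<close> and \<open>(False, x)\<close> for its formal
  inverse. The group presented by \<open>X\<close> and \<open>R\<close> is the monoid of signed words, presented by the
  relations \<open>R\<close> between positive words together with the free cancellation relations.\<close>

abbreviation pos_word :: "'x list \<Rightarrow> (bool \<times> 'x) list"
  where "pos_word \<equiv> map (Pair True)"

definition group_relations ::
    "'x set \<Rightarrow> ('x list \<times> 'x list) set \<Rightarrow> ((bool \<times> 'x) list \<times> (bool \<times> 'x) list) set"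
  where "group_relations X R =
    {(pos_word l, pos_word r) | l r. (l, r) \<in> R} \<union>
    {([(b, x), (\<not> b, x)], []) | b x. x \<in> X}"

definition presented_group ::
    "'x set \<Rightarrow> ('x list \<times> 'x list) set \<Rightarrow> (bool \<times> 'x) list set monoid"
  where "presented_group X R = presented_monoid (UNIV \<times> X) (group_relations X R)"

text \<open>The homomorphism that maps the class of each positive word to its class in the group;
  the union is over equal sets when \<open>C\<close> is a congruence class.\<close>

definition canonical_map ::
    "'x set \<Rightarrow> ('x list \<times> 'x list) set \<Rightarrow> 'x list set \<Rightarrow> (bool \<times> 'x) list set"
  where "canonical_map X R C =
    (\<Union>w\<in>C. presented_cong (UNIV \<times> X) (group_relations X R) `` {pos_word w})"

definition generated_submonoid :: "('a, 'b) monoid_scheme \<Rightarrow> 'a set \<Rightarrow> 'a set"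
  where "generated_submonoid M S = \<Inter> {H. submonoid H M \<and> S \<subseteq> H}"

definition torsion_free :: "('a, 'b) monoid_scheme \<Rightarrow> bool"
  where "torsion_free G \<longleftrightarrow>
    (\<forall>x \<in> carrier G. \<forall>n::nat. n > 0 \<longrightarrow> x [^]\<^bsub>G\<^esub> n = \<one>\<^bsub>G\<^esub> \<longrightarrow> x = \<one>\<^bsub>G\<^esub>)"

datatype letter = Sig nat | Let nat

text \<open>Generators are indexed from 1; the letters \<open>Sig 0\<close> and \<open>Let 0\<close> are not used.\<close>

definition gens :: "letter set"
  where "gens = {Sig i | i. i \<ge> 1} \<union> {Let i | i. i \<ge> 1}"

inductive_set R_bullet :: "(letter list \<times> letter list) set"
  where
    "\<lbrakk>i \<ge> 1; j \<ge> i + 2\<rbrakk> \<Longrightarrow> ([Sig i, Sig j], [Sig j, Sig i]) \<in> R_bullet"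
  | "\<lbrakk>i \<ge> 1; j \<ge> i + 2\<rbrakk> \<Longrightarrow> ([Sig i, Let j], [Let j, Sig i]) \<in> R_bullet"
  | "\<lbrakk>i \<ge> 1; j \<ge> i + 2\<rbrakk> \<Longrightarrow> ([Let i, Let (j - 1)], [Let j, Let i]) \<in> R_bullet"
  | "\<lbrakk>i \<ge> 1; j \<ge> i + 2\<rbrakk> \<Longrightarrow> ([Let i, Sig (j - 1)], [Sig j, Let i]) \<in> R_bullet"
  | "i \<ge> 1 \<Longrightarrow>
      ([Sig i, Sig (i + 1), Sig i], [Sig (i + 1), Sig i, Sig (i + 1)]) \<in> R_bullet"
  | "i \<ge> 1 \<Longrightarrow> ([Sig (i + 1), Sig i, Let (i + 1)], [Let i, Sig i]) \<in> R_bullet"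
  | "i \<ge> 1 \<Longrightarrow> ([Sig i, Sig (i + 1), Let i], [Let (i + 1), Sig i]) \<in> R_bullet"

definition B_group :: "(bool \<times> letter) list set monoid"
  where "B_group = presented_group gens R_bullet"

definition B_monoid :: "letter list set monoid"
  where "B_monoid = presented_monoid gens R_bullet"

definition B_canon :: "letter list set \<Rightarrow> (bool \<times> letter) list set"
  where "B_canon = canonical_map gens R_bullet"

definition braid_submonoid :: "letter list set set"
  where "braid_submonoid =
    generated_submonoid B_monoid {presented_cong gens R_bullet `` {[Sig i]} | i. i \<ge> 1}"

definition thompson_submonoid :: "letter list set set"
  where "thompson_submonoid =
    generated_submonoid B_monoid {presented_cong gens R_bullet `` {[Let i]} | i. i \<ge> 1}"

lemma presented_cong_lists:
  "(v, w) \<in> presented_cong X R \<Longrightarrow> v \<in> lists X \<and> w \<in> lists X"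
  by (induction rule: presented_cong.induct) auto

lemma equiv_presented_cong: "equiv (lists X) (presented_cong X R)"
proof (rule equivI)
  show "presented_cong X R \<subseteq> lists X \<times> lists X"
    using presented_cong_lists by fast
  show "refl_on (lists X) (presented_cong X R)"
    unfolding refl_on_def by (blast intro: presented_cong.refl)
  show "sym (presented_cong X R)"
    unfolding sym_def by (blast intro: presented_cong.sym)
  show "trans (presented_cong X R)"
    unfolding trans_def by (blast intro: presented_cong.trans)
qed

lemma presented_cong_context:
  assumes "(v, w) \<in> presented_cong X R" "p \<in> lists X" "q \<in> lists X"
  shows "(p @ v @ q, p @ w @ q) \<in> presented_cong X R"
  using assms
proof (induction rule: presented_cong.induct)
  case (refl w)
  then show ?case by (simp add: presented_cong.refl)
next
  case (step l r u v)
  then show ?case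
    using presented_cong.step[of l r R "p @ u" "v @ q" X] by simp
next
  case (sym v w)
  then show ?case by (simp add: presented_cong.sym)
next
  case (trans u v w)
  show ?case
    by (rule presented_cong.trans[OF trans.IH(1)[OF trans.prems] trans.IH(2)[OF trans.prems]])
qed

lemma presented_cong_append:
  assumes "(u, u') \<in> presented_cong X R" "(v, v') \<in> presented_cong X R"
  shows "(u @ v, u' @ v') \<in> presented_cong X R"
proof -
  have "(u @ v, u' @ v) \<in> presented_cong X R"
    using presented_cong_context[of u u' X R "[]" v] assms presented_cong_lists by fastforce
  moreover have "(u' @ v, u' @ v') \<in> presented_cong X R"
    using presented_cong_context[of v v' X R u' "[]"] assms presented_cong_lists by fastforce
  ultimately show ?thesis by (rule presented_cong.trans)
qed

lemma presented_cong_class_eq: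
  "(v, w) \<in> presented_cong X R \<Longrightarrow> presented_cong X R `` {v} = presented_cong X R `` {w}"
  by (rule equiv_class_eq[OF equiv_presented_cong])

lemma presented_cong_self: "w \<in> lists X \<Longrightarrow> w \<in> presented_cong X R `` {w}"
  by (simp add: presented_cong.refl)

lemma presented_monoid_one [simp]:
  "\<one>\<^bsub>presented_monoid X R\<^esub> = presented_cong X R `` {[]}"
  by (simp add: presented_monoid_def)

lemma presented_monoid_mult [simp]:
  assumes "u \<in> lists X" "v \<in> lists X"
  shows "presented_cong X R `` {u} \<otimes>\<^bsub>presented_monoid X R\<^esub> presented_cong X R `` {v}
    = presented_cong X R `` {u @ v}"
proof -
  have "presented_cong X R `` {u' @ v'} = presented_cong X R `` {u @ v}"
    if "(u, u') \<in> presented_cong X R" "(v, v') \<in> presented_cong X R" for u' v'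
    using presented_cong_class_eq[OF presented_cong_append[OF that]] by simp
  then have "(\<Union>v'\<in>presented_cong X R `` {v}. presented_cong X R `` {u' @ v'})
      = presented_cong X R `` {u @ v}" if "u' \<in> presented_cong X R `` {u}" for u'
    using that presented_cong_self[OF assms(2), of R] by (intro UN_constant_eq) auto
  then have "(\<Union>u'\<in>presented_cong X R `` {u}. \<Union>v'\<in>presented_cong X R `` {v}.
      presented_cong X R `` {u' @ v'}) = presented_cong X R `` {u @ v}"
    using presented_cong_self[OF assms(1), of R] by (intro UN_constant_eq) auto
  then show ?thesis by (simp add: presented_monoid_def)
qed

lemma presented_monoid_closed [simp]:
  "w \<in> lists X \<Longrightarrow> presented_cong X R `` {w} \<in> carrier (presented_monoid X R)"
  by (simp add: presented_monoid_def quotientI)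

lemma presented_monoid_cases:
  assumes "C \<in> carrier (presented_monoid X R)"
  obtains w where "w \<in> lists X" "C = presented_cong X R `` {w}"
  using assms unfolding presented_monoid_def by (auto simp del: in_lists_conv_set elim!: quotientE)

lemma monoid_presented_monoid: "monoid (presented_monoid X R)"
proof -
  let ?M = "presented_monoid X R" and ?c = "presented_cong X R"
  have append: "u @ v \<in> lists X" if "u \<in> lists X" "v \<in> lists X" for u v
    using that by auto
  have nil: "[] \<in> lists X" by simp
  show ?thesis
  proof (rule monoidI)
    fix C D
    assume "C \<in> carrier ?M" "D \<in> carrier ?M"
    then obtain u v where "u \<in> lists X" "C = ?c `` {u}" "v \<in> lists X" "D = ?c `` {v}"
      by (metis presented_monoid_cases)
    then show "C \<otimes>\<^bsub>?M\<^esub> D \<in> carrier ?M"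
      by (simp only: presented_monoid_mult presented_monoid_closed append)
  next
    show "\<one>\<^bsub>?M\<^esub> \<in> carrier ?M"
      by (simp only: presented_monoid_one presented_monoid_closed nil)
  next
    fix C D E
    assume "C \<in> carrier ?M" "D \<in> carrier ?M" "E \<in> carrier ?M"
    then obtain u v w where "u \<in> lists X" "C = ?c `` {u}" "v \<in> lists X" "D = ?c `` {v}"
        "w \<in> lists X" "E = ?c `` {w}"
      by (metis presented_monoid_cases)
    then show "C \<otimes>\<^bsub>?M\<^esub> D \<otimes>\<^bsub>?M\<^esub> E = C \<otimes>\<^bsub>?M\<^esub> (D \<otimes>\<^bsub>?M\<^esub> E)"
      by (simp only: presented_monoid_mult append append_assoc)
  next
    fix C assume "C \<in> carrier ?M"
    then obtain u where u: "u \<in> lists X" "C = ?c `` {u}" by (rule presented_monoid_cases)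
    show "\<one>\<^bsub>?M\<^esub> \<otimes>\<^bsub>?M\<^esub> C = C"
      using u by (simp only: presented_monoid_one presented_monoid_mult nil append_Nil)
    show "C \<otimes>\<^bsub>?M\<^esub> \<one>\<^bsub>?M\<^esub> = C"
      using u by (simp only: presented_monoid_one presented_monoid_mult nil append_Nil2)
  qed
qed

lemma group_presented_group: "group (presented_group X R)"
proof -
  let ?Y = "UNIV \<times> X :: (bool \<times> 'a) set" and ?S = "group_relations X R"
  let ?c = "presented_cong ?Y ?S"
  interpret monoid "presented_group X R"
    unfolding presented_group_def by (rule monoid_presented_monoid)
  have inv: "\<exists>v \<in> lists ?Y. (v @ w, []) \<in> ?c" if "w \<in> lists ?Y" for w
    using that
  proof (induction w)
    case Nil
    then show ?case by (auto intro: bexI[of _ "[]"] presented_cong.refl)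
  next
    case (Cons y w)
    obtain b x where y: "y = (b, x)" "x \<in> X" using Cons.hyps by auto
    obtain v where v: "v \<in> lists ?Y" "(v @ w, []) \<in> ?c" using Cons.IH by auto
    have "([(\<not> b, x), (\<not> (\<not> b), x)], []) \<in> ?S"
      using y(2) unfolding group_relations_def by blast
    then have "(v @ [(\<not> b, x), (b, x)] @ w, v @ [] @ w) \<in> ?c"
      using y v(1) Cons.hyps by (intro presented_cong.step) auto
    then have "((v @ [(\<not> b, x)]) @ y # w, []) \<in> ?c"
      using v(2) y(1) by (auto intro: presented_cong.trans)
    then show ?case using v(1) y(2) by (intro bexI[of _ "v @ [(\<not> b, x)]"]) auto
  qed
  show ?thesis
  proof (rule groupI)
    fix C assume "C \<in> carrier (presented_group X R)"
    then obtain w where w: "w \<in> lists ?Y" "C = ?c `` {w}"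
      unfolding presented_group_def by (rule presented_monoid_cases)
    obtain v where v: "v \<in> lists ?Y" "(v @ w, []) \<in> ?c" using inv[OF w(1)] by auto
    have "?c `` {v} \<otimes>\<^bsub>presented_group X R\<^esub> C = \<one>\<^bsub>presented_group X R\<^esub>"
      unfolding presented_group_def w(2) presented_monoid_mult[OF v(1) w(1)] presented_monoid_one
      by (rule presented_cong_class_eq[OF v(2)])
    then show "\<exists>D \<in> carrier (presented_group X R).
        D \<otimes>\<^bsub>presented_group X R\<^esub> C = \<one>\<^bsub>presented_group X R\<^esub>"
      using presented_monoid_closed[OF v(1)] unfolding presented_group_def by blast
  qed (auto simp: m_assoc)
qed

lemma pos_word_lists: "w \<in> lists X \<Longrightarrow> pos_word w \<in> lists (UNIV \<times> X)"
  by auto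

lemma canonical_map_class:
  assumes "w \<in> lists X"
  shows "canonical_map X R (presented_cong X R `` {w})
    = presented_cong (UNIV \<times> X) (group_relations X R) `` {pos_word w}"
proof -
  let ?d = "presented_cong (UNIV \<times> X) (group_relations X R)"
  have "(pos_word u, pos_word v) \<in> ?d" if "(u, v) \<in> presented_cong X R" for u v
    using that
  proof (induction rule: presented_cong.induct)
    case (refl w)
    then show ?case by (intro presented_cong.refl pos_word_lists)
  next
    case (step l r u v)
    have "(pos_word l, pos_word r) \<in> group_relations X R"
      using step(1) unfolding group_relations_def by blast
    moreover have "pos_word u @ pos_word l @ pos_word v \<in> lists (UNIV \<times> X)"
      "pos_word u @ pos_word r @ pos_word v \<in> lists (UNIV \<times> X)"
      using step(2,3) by auto
    ultimately show ?case by (simp add: presented_cong.step)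
  next
    case (sym v w)
    then show ?case by (simp add: presented_cong.sym)
  next
    case (trans u v w)
    show ?case by (rule presented_cong.trans[OF trans.IH])
  qed
  then have "?d `` {pos_word v} = ?d `` {pos_word w}" if "(w, v) \<in> presented_cong X R" for v
    by (rule presented_cong_class_eq[symmetric]) (rule that)
  then have eq: "?d `` {pos_word v} = ?d `` {pos_word w}" if "v \<in> presented_cong X R `` {w}" for v
    using that by (simp only: Image_singleton_iff)
  show ?thesis
    unfolding canonical_map_def by (rule UN_constant_eq[OF presented_cong_self[OF assms] ballI[OF eq]])
qed

end

theory Submission
  imports Defs
begin

text \<open>
  For any two distinct letters \<open>s\<close>, \<open>t\<close> exactly one relation has the form \<open>u s = v t\<close>. An equality \<open>x s = y t\<close>
  in the monoid therefore ought to come from this relation by left multiplication. This is proved by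
  Garside's induction: the induction variable is a length function that increases strictly under
  right multiplication, and the induction step is a cube condition on triples of letters. It yields
  right cancellation and left lcms of elements that have a common left multiple.

  Pushing a letter \<open>a\<close> to the right across a crossing doubles one strand of that crossing,
  so every element is \<open>\<beta> f\<close> with a unique braid \<open>\<beta>\<close> and a unique \<open>f\<close> in Thompson's monoid. Left
  cancellation of \<open>\<sigma>\<close> follows by reversing braid words, left cancellation of \<open>a\<close> by deleting one of
  the two strands that \<open>a\<close> joins. Common left multiples exist because braids have Garside elements
  and the letters \<open>a\<close> can be pushed through any word. This is the setting of Ore's theorem.

  If \<open>z\<close> has finite order, take \<open>d\<close> such that all \<open>d z\<^sup>i\<close> are in the monoid, and let \<open>m\<close> be their left lcm.
  Right multiplication by \<open>z\<close> permutes the \<open>d z\<^sup>i\<close>, so \<open>m z = v m\<close> for some \<open>v\<close> in the monoid; then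
  \<open>v\<close> has finite order as well, hence \<open>v = 1\<close> and \<open>z = 1\<close>.
\<close>

section \<open>The monoid as a type\<close>

text \<open>Indices start at 0 for \<open>bmon\<close>, so that all letters are generators and no side conditions
  are needed; \<open>raise\<close> and \<open>lower\<close> translate to and from the indices of \<open>gens\<close>.\<close>

definition switch :: "nat \<Rightarrow> nat \<Rightarrow> nat"
  where "switch k i = (if i = k then Suc k else if i = Suc k then k else i)"

text \<open>For \<open>j\<close> different from \<open>i\<close>, the position of strand
  \<open>j\<close> to the left of a letter \<open>Let i\<close>, which splits strand
  \<open>i\<close> in two when read from the right.\<close>

definition bump :: "nat \<Rightarrow> nat \<Rightarrow> nat"
  where "bump i j = (if i < j then Suc j else j)"

text \<open>The crossing \<open>Sig k\<close> with the strand that ends at position \<open>i\<close> doubled.\<close>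

definition cable :: "nat \<Rightarrow> nat \<Rightarrow> letter list"
  where "cable i k =
    (if i < k then [Sig (Suc k)] else if i = k then [Sig k, Sig (Suc k)]
     else if i = Suc k then [Sig (Suc k), Sig k] else [Sig k])"

text \<open>The relation for the pair \<open>s\<close>, \<open>t\<close> of last letters is \<open>cpl s t @ [s] = cpl t s @ [t]\<close>.\<close>

fun cpl :: "letter \<Rightarrow> letter \<Rightarrow> letter list"
  where
    "cpl (Sig j) (Sig k) =
      (if j = k then [] else if j = Suc k \<or> k = Suc j then [Sig j, Sig k] else [Sig k])"
  | "cpl (Sig k) (Let i) = [Let (switch k i)]"
  | "cpl (Let i) (Sig k) = cable i k"
  | "cpl (Let i) (Let j) = (if i = j then [] else [Let (bump i j)])"

definition rels :: "(letter list \<times> letter list) set"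
  where "rels = {(cpl s t @ [s], cpl t s @ [t]) | s t. True}"

abbreviation cong :: "letter list \<Rightarrow> letter list \<Rightarrow> bool"
  where "cong u v \<equiv> (u, v) \<in> presented_cong UNIV rels"

lemma cong_induct [consumes 1, case_names refl step sym trans]:
  assumes "cong u v"
    and "\<And>u. P u u"
    and "\<And>u s t v. P (u @ cpl s t @ s # v) (u @ cpl t s @ t # v)"
    and "\<And>u v. cong u v \<Longrightarrow> P u v \<Longrightarrow> P v u"
    and "\<And>u v w. cong u v \<Longrightarrow> P u v \<Longrightarrow> cong v w \<Longrightarrow> P v w \<Longrightarrow> P u w"
  shows "P u v"
  using assms(1)
proof (induction rule: presented_cong.induct)
  case (step l r u v)
  then obtain s t where "l = cpl s t @ [s]" "r = cpl t s @ [t]"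
    unfolding rels_def by blast
  then show ?case using assms(3)[of u s t v] by simp
qed (use assms in blast)+

lemma equivp_cong: "equivp cong"
  by (rule equivpI) (auto intro!: reflpI sympI transpI intro: presented_cong.intros)

quotient_type bmon = "letter list" / cong
  by (rule equivp_cong)

instantiation bmon :: monoid_mult
begin

lift_definition one_bmon :: bmon is "[]" .

lift_definition times_bmon :: "bmon \<Rightarrow> bmon \<Rightarrow> bmon" is "(@)"
  by (rule presented_cong_append)

instance
  by standard (transfer; simp add: presented_cong.refl)+

end

lift_definition cls :: "letter list \<Rightarrow> bmon" is "\<lambda>u. u" .

lemma cls_eq: "cls u = cls v \<longleftrightarrow> cong u v"
  by transfer simp

lemma cls_Nil [simp]: "cls [] = 1"
  by transfer (simp add: presented_cong.refl)

lemma cls_append [simp]: "cls (u @ v) = cls u * cls v"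
  by transfer (simp add: presented_cong.refl)

abbreviation gen :: "letter \<Rightarrow> bmon"
  where "gen s \<equiv> cls [s]"

abbreviation sg :: "nat \<Rightarrow> bmon"
  where "sg k \<equiv> cls [Sig k]"

abbreviation al :: "nat \<Rightarrow> bmon"
  where "al i \<equiv> cls [Let i]"

lemma cls_Cons: "cls (s # v) = gen s * cls v"
  using cls_append[of "[s]" v] by simp

lemma cls_Cons2 [simp]: "cls (s # t # v) = gen s * cls (t # v)"
  by (rule cls_Cons)

lemma cls_surj: obtains u where "x = cls u"
  by transfer (auto intro: presented_cong.refl)

lemma bmon_induct [case_names one snoc]:
  assumes "P 1" "\<And>x s. P x \<Longrightarrow> P (x * gen s)"
  shows "P x"
proof -
  obtain u where "x = cls u" by (rule cls_surj)
  moreover have "P (cls u)"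
    using assms by (induction u rule: rev_induct) simp_all
  ultimately show ?thesis by simp
qed

lemma cpl_rel: "cls (cpl s t) * gen s = cls (cpl t s) * gen t"
proof -
  have "(cpl s t @ [s], cpl t s @ [t]) \<in> rels" unfolding rels_def by blast
  then have "cong ([] @ (cpl s t @ [s]) @ []) ([] @ (cpl t s @ [t]) @ [])"
    by (intro presented_cong.step) auto
  then show ?thesis by (simp flip: cls_eq)
qed

text \<open>The relations do not preserve the number of letters. Instead, give each strand a weight,
  initially 1: reading a word from the left, \<open>Let i\<close> joins two strands and adds their weights, and a
  crossing costs the product of the weights of the two strands.\<close>

fun wstate :: "(nat \<Rightarrow> nat) \<Rightarrow> letter list \<Rightarrow> nat \<Rightarrow> nat"
  where
    "wstate w [] = w"
  | "wstate w (Sig k # v) = wstate (\<lambda>n. w (switch k n)) v"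
  | "wstate w (Let i # v) =
      wstate (\<lambda>n. if n < i then w n else if n = i then w i + w (Suc i) else w (Suc n)) v"

fun wlen :: "(nat \<Rightarrow> nat) \<Rightarrow> letter list \<Rightarrow> nat"
  where
    "wlen w [] = 0"
  | "wlen w (Sig k # v) = w k * w (Suc k) + wlen (\<lambda>n. w (switch k n)) v"
  | "wlen w (Let i # v) =
      1 + wlen (\<lambda>n. if n < i then w n else if n = i then w i + w (Suc i) else w (Suc n)) v"

lemma wlen_append: "wlen w (u @ v) = wlen w u + wlen (wstate w u) v"
  by (induction w u rule: wlen.induct) auto

lemma wstate_pos: "(\<And>n. w n > 0) \<Longrightarrow> wstate w u n > 0"
  by (induction w u arbitrary: n rule: wstate.induct) auto

lemma wstate_rel: "wstate w (cpl s t @ [s]) = wstate w (cpl t s @ [t])"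
  by (cases s; cases t) (auto simp: fun_eq_iff switch_def bump_def cable_def)

text \<open>A crossing with a joined strand costs \<open>a * (b + c)\<close>; pushing the join
  across it leaves two crossings, of costs \<open>a * b\<close> and \<open>a * c\<close>. The other
  relations only permute equal costs.\<close>

lemma wlen_rel: "wlen w (cpl s t @ [s]) = wlen w (cpl t s @ [t])"
  by (cases s; cases t) (auto simp: fun_eq_iff switch_def bump_def cable_def algebra_simps)

lemma wlen_cong: "cong u v \<Longrightarrow> wlen w u = wlen w v"
proof (induction rule: cong_induct)
  case (step u s t v)
  have "wlen w' ((cpl s t @ [s]) @ v) = wlen w' ((cpl t s @ [t]) @ v)" for w'
    by (simp only: wlen_append[of _ "_ @ _" v] wstate_rel[of _ s t] wlen_rel[of _ s t])
  then have "wlen w (u @ (cpl s t @ [s]) @ v) = wlen w (u @ (cpl t s @ [t]) @ v)"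
    by (simp only: wlen_append[of _ u])
  then show ?case by simp
qed auto

lift_definition weight :: "bmon \<Rightarrow> nat" is "wlen (\<lambda>_. 1)"
  by (rule wlen_cong)

lemma weight_cls: "weight (cls u) = wlen (\<lambda>_. 1) u"
  by transfer simp

lemma weight_mult_ge: "weight x \<le> weight (x * y)"
proof -
  obtain u v where "x = cls u" "y = cls v" by (meson cls_surj)
  then show ?thesis by (simp add: weight_cls wlen_append flip: cls_append)
qed

text \<open>All strand weights stay positive along a word, so a further letter on the right costs at
  least 1.\<close>

lemma weight_mult_gen_less: "weight x < weight (x * gen s)"
proof -
  obtain u where x: "x = cls u" by (rule cls_surj)
  have "wstate (\<lambda>_. 1) u n > 0" for n by (rule wstate_pos) simp
  then have "wlen (wstate (\<lambda>_. 1) u) [s] > 0" by (cases s) auto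
  then show ?thesis by (simp add: x weight_cls wlen_append flip: cls_append)
qed

lemma weight_eq_0: "weight x = 0 \<Longrightarrow> x = 1"
  using weight_mult_gen_less by (induction x rule: bmon_induct) (metis not_less_zero)+

section \<open>Cables\<close>

definition adj :: "nat \<Rightarrow> nat \<Rightarrow> bool"
  where "adj j k \<longleftrightarrow> j = Suc k \<or> k = Suc j"

definition far :: "nat \<Rightarrow> nat \<Rightarrow> bool"
  where "far j k \<longleftrightarrow> Suc j < k \<or> Suc k < j"

lemma far_sym: "far j k \<Longrightarrow> far k j" and adj_sym: "adj j k \<Longrightarrow> adj k j"
  by (auto simp: far_def adj_def)

lemma cases_adj_far [case_names eq adj far]:
  obtains "j = k" | "adj j k" | "far j k"
  unfolding adj_def far_def by linarith

lemma cpl_sig: "far j k \<Longrightarrow> cpl (Sig j) (Sig k) = [Sig k]"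
    "adj j k \<Longrightarrow> cpl (Sig j) (Sig k) = [Sig j, Sig k]"
  by (auto simp: far_def adj_def)

lemma sg_far: "far j k \<Longrightarrow> sg j * sg k = sg k * sg j"
  using cpl_rel[of "Sig k" "Sig j"] by (simp add: cpl_sig far_sym del: cpl.simps)

lemma sg_far': "far j k \<Longrightarrow> x * sg j * sg k = x * sg k * sg j"
  by (metis mult.assoc sg_far)

lemma sg_adj: "adj j k \<Longrightarrow> sg j * sg k * sg j = sg k * sg j * sg k"
  using cpl_rel[of "Sig j" "Sig k"] by (simp add: cpl_sig adj_sym del: cpl.simps)

lemma sg_adj': "adj j k \<Longrightarrow> x * sg j * sg k * sg j = x * sg k * sg j * sg k"
  using sg_adj[of j k] by (simp add: mult.assoc)

definition cab :: "nat \<Rightarrow> nat \<Rightarrow> bmon"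
  where "cab i k = cls (cable i k)"

lemma al_sg: "al (switch k i) * sg k = cab i k * al i"
  using cpl_rel[of "Sig k" "Let i"] by (simp add: cab_def)

lemma al_sg': "x * al (switch k i) * sg k = x * cab i k * al i"
  by (simp add: mult.assoc al_sg)

lemma al_al: "i \<noteq> j \<Longrightarrow> al (bump i j) * al i = al (bump j i) * al j"
  using cpl_rel[of "Let i" "Let j"] by simp

lemma al_al': "i \<noteq> j \<Longrightarrow> x * al (bump i j) * al i = x * al (bump j i) * al j"
  by (simp add: mult.assoc al_al)

lemma switch_far: "far j k \<Longrightarrow> switch j (switch k i) = switch k (switch j i)"
  by (auto simp: far_def switch_def)

lemma switch_adj: "adj j k \<Longrightarrow> switch j (switch k (switch j i)) = switch k (switch j (switch k i))"
  by (auto simp: adj_def switch_def)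

lemma cab_cases:
  "i < k \<Longrightarrow> cab i k = sg (Suc k)"
  "i = k \<Longrightarrow> cab i k = sg k * sg (Suc k)"
  "i = Suc k \<Longrightarrow> cab i k = sg (Suc k) * sg k"
  "Suc k < i \<Longrightarrow> cab i k = sg k"
  by (auto simp: cab_def cable_def)

lemma switch_cases:
  "i < k \<Longrightarrow> switch k i = i"
  "i = k \<Longrightarrow> switch k i = Suc k"
  "i = Suc k \<Longrightarrow> switch k i = k"
  "Suc k < i \<Longrightarrow> switch k i = i"
  by (auto simp: switch_def)

lemma sg_sort: "Suc k < j \<Longrightarrow> sg j * sg k = sg k * sg j"
    "Suc k < j \<Longrightarrow> x * sg j * sg k = x * sg k * sg j"
  by (simp_all add: sg_far sg_far' far_def)

text \<open>The two sides are the two orders of the crossings \<open>j\<close> and \<open>k\<close>,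
  with the strand that ends at \<open>i\<close> doubled. So doubling respects far commutation;
  \<open>cab_adj\<close> does the same for the braid relation.\<close>

lemma cab_far:
  assumes "far j k"
  shows "cab (switch k i) j * cab i k = cab (switch j i) k * cab i j"
proof -
  have *: "cab (switch k i) j * cab i k = cab (switch j i) k * cab i j" if "Suc j < k" for j k
  proof -
    consider "i < j" | "i = j" | "i = Suc j" | "Suc j < i" "i < k" | "i = k" | "i = Suc k" | "Suc k < i"
      by linarith
    then show ?thesis
      by cases (use that in \<open>simp_all add: cab_cases switch_cases sg_sort flip: mult.assoc\<close>)
  qed
  from assms consider "Suc j < k" | "Suc k < j" unfolding far_def by blast
  then show ?thesis by cases (rule *, assumption, rule *[symmetric])
qed

lemma cab_adj:
  assumes "adj j k"
  shows "cab (switch j (switch k i)) k * cab (switch k i) j * cab i k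
    = cab (switch k (switch j i)) j * cab (switch j i) k * cab i j"
proof -
  \<comment> \<open>The claim is symmetric in \<open>j\<close> and \<open>k\<close>, so
    \<open>k = Suc j\<close> suffices. A doubled strand away from the three positions only keeps or
    shifts the relation; the three other cases are identities in \<open>?a\<close>,
    \<open>?b\<close>, \<open>?c\<close>.\<close>
  have *: "cab (switch j (switch k i)) k * cab (switch k i) j * cab i k
    = cab (switch k (switch j i)) j * cab (switch j i) k * cab i j" if k: "k = Suc j" for j k
  proof -
    let ?a = "sg j" and ?b = "sg (Suc j)" and ?c = "sg (Suc (Suc j))"
    have ac: "x * ?c * ?a = x * ?a * ?c" "?c * ?a = ?a * ?c" for x
      by (simp_all add: sg_sort)
    have ab: "x * ?a * ?b * ?a = x * ?b * ?a * ?b" "?a * ?b * ?a = ?b * ?a * ?b" for x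
      using sg_adj'[of j "Suc j"] sg_adj[of j "Suc j"] unfolding adj_def by blast+
    have bc: "x * ?b * ?c * ?b = x * ?c * ?b * ?c" "?b * ?c * ?b = ?c * ?b * ?c" for x
      using sg_adj'[of "Suc j" "Suc (Suc j)"] sg_adj[of "Suc j" "Suc (Suc j)"]
      unfolding adj_def by blast+
    consider "i < j" | "i = j" | "i = Suc j" | "i = Suc (Suc j)" | "Suc (Suc j) < i"
      by linarith
    then show ?thesis
    proof cases
      case 2
      have "?b * ?c * ?a * ?b * ?c = ?b * ?a * ?c * ?b * ?c"
        by (simp only: ac)
      also have "\<dots> = ?b * ?a * ?b * ?c * ?b"
        by (simp only: bc)
      also have "\<dots> = ?a * ?b * ?a * ?c * ?b"
        by (simp only: ab)
      also have "\<dots> = ?a * ?b * ?c * ?a * ?b"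
        by (simp only: ac)
      finally have "?b * ?c * ?a * ?b * ?c = ?a * ?b * ?c * ?a * ?b" .
      then show ?thesis using 2 k by (simp add: cab_cases switch_cases flip: mult.assoc)
    next
      case 3
      have "?c * ?b * ?a * ?b * ?c = ?c * ?a * ?b * ?a * ?c"
        by (simp only: ab)
      also have "\<dots> = ?a * ?c * ?b * ?c * ?a"
        by (simp only: ac)
      also have "\<dots> = ?a * ?b * ?c * ?b * ?a"
        by (simp only: bc)
      finally have "?c * ?b * ?a * ?b * ?c = ?a * ?b * ?c * ?b * ?a" .
      then show ?thesis using 3 k by (simp add: cab_cases switch_cases flip: mult.assoc)
    next
      case 4
      have "?c * ?b * ?a * ?c * ?b = ?c * ?b * ?c * ?a * ?b"
        by (simp only: ac)
      also have "\<dots> = ?b * ?c * ?b * ?a * ?b"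
        by (simp only: bc)
      also have "\<dots> = ?b * ?c * ?a * ?b * ?a"
        by (simp only: ab)
      also have "\<dots> = ?b * ?a * ?c * ?b * ?a"
        by (simp only: ac)
      finally have "?c * ?b * ?a * ?c * ?b = ?b * ?a * ?c * ?b * ?a" .
      then show ?thesis using 4 k by (simp add: cab_cases switch_cases flip: mult.assoc)
    qed (use k in \<open>simp_all add: cab_cases switch_cases ab bc\<close>)
  qed
  from assms consider "k = Suc j" | "j = Suc k" unfolding adj_def by blast
  then show ?thesis by cases (rule *, assumption, rule *[symmetric])
qed

text \<open>In a braid word, \<open>switchs\<close> traces the strand that ends at \<open>x\<close>
  back to its beginning, and \<open>cabs\<close> doubles this strand; \<open>al_sgs\<close> pushes a
  joining letter through the whole word.\<close>

fun switchs :: "nat list \<Rightarrow> nat \<Rightarrow> nat"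
  where
    "switchs [] x = x"
  | "switchs (k # v) x = switch k (switchs v x)"

fun cabs :: "nat \<Rightarrow> nat list \<Rightarrow> bmon"
  where
    "cabs x [] = 1"
  | "cabs x (k # v) = cab (switchs v x) k * cabs x v"

definition cable_ind :: "nat \<Rightarrow> nat \<Rightarrow> nat list"
  where "cable_ind i k =
    (if i < k then [Suc k] else if i = k then [k, Suc k]
     else if i = Suc k then [Suc k, k] else [k])"

abbreviation sgs :: "nat list \<Rightarrow> bmon"
  where "sgs u \<equiv> cls (map Sig u)"

lemma sgs_Cons: "sgs (k # u) = sg k * sgs u"
  using cls_Cons[of "Sig k" "map Sig u"] by simp

lemma cable_ind: "map Sig (cable_ind i k) = cable i k"
  by (simp add: cable_ind_def cable_def)

lemma sgs_cable_ind: "sgs (cable_ind i k) = cab i k"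
  by (simp add: cable_ind cab_def)

lemma al_sgs: "al (switchs u x) * sgs u = cabs x u * al x"
proof (induction u)
  case (Cons k u)
  have "al (switchs (k # u) x) * sgs (k # u) = al (switch k (switchs u x)) * sg k * sgs u"
    by (simp add: sgs_Cons mult.assoc del: list.map)
  also have "\<dots> = cab (switchs u x) k * (al (switchs u x) * sgs u)"
    by (simp add: al_sg mult.assoc)
  finally show ?case using Cons by (simp add: mult.assoc)
qed simp

lemma switchs_append: "switchs (u @ v) x = switchs u (switchs v x)"
  by (induction u) auto

lemma cabs_append: "cabs x (u @ v) = cabs (switchs v x) u * cabs x v"
  by (induction u) (auto simp: switchs_append mult.assoc)

lemma switchs_cable: "i \<noteq> j \<Longrightarrow> switchs (cable_ind i k) (bump i j) = bump (switch k i) (switch k j)"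
  by (auto simp: cable_ind_def switch_def bump_def)

text \<open>Two strands of a crossing can be doubled in either order; \<open>bump\<close> accounts
  for the shift of one strand by the doubling of the other.\<close>

lemma cabs_cable:
  assumes "i \<noteq> j"
  shows "cabs (bump i j) (cable_ind i k) = cabs (bump j i) (cable_ind j k)"
proof -
  have *: "cabs (bump i j) (cable_ind i k) = cabs (bump j i) (cable_ind j k)" if "i < j" for i j
  proof -
    consider "i < k" | "i = k" | "i = Suc k" | "Suc k < i" by linarith
    moreover consider "j < k" | "j = k" | "j = Suc k" | "Suc k < j" by linarith
    ultimately show ?thesis
      by cases (use that in \<open>auto simp: cable_ind_def bump_def cab_cases switch_cases sg_sort simp flip: mult.assoc\<close>)
  qed
  from assms consider "i < j" | "j < i" by linarith
  then show ?thesis by cases (rule *, assumption, rule *[symmetric])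
qed

lemma bump_bump:
  "i \<noteq> j \<Longrightarrow> bump (bump i j) (bump i k) = bump (bump j i) (bump j k)"
  "bump i j = bump i k \<longleftrightarrow> j = k"
  by (auto simp: bump_def)

section \<open>Left lcms of generators\<close>

text \<open>The hypothesis of Garside's induction: \<open>gen_lcm\<close> for equalities of weight
  below \<open>N\<close>. Its consequences carry the side condition \<open>ok\<close>, which passes
  to left factors by \<open>okD\<close>.\<close>

locale lcm_below =
  fixes N :: nat
  assumes gen_lcm: "\<lbrakk>weight (x * gen s) < N; x * gen s = y * gen t\<rbrakk>
      \<Longrightarrow> \<exists>q. x = q * cls (cpl s t) \<and> y = q * cls (cpl t s)"
begin

abbreviation ok :: "bmon \<Rightarrow> bool"
  where "ok x \<equiv> weight x < N"

lemma okD: "ok (x * y) \<Longrightarrow> ok x"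
  using weight_mult_ge[of x y] by linarith

text \<open>The case \<open>s = t\<close> of the hypothesis, where \<open>cpl s s\<close> is
  empty.\<close>

lemma cancel_gen: "\<lbrakk>ok (x * gen s); x * gen s = y * gen s\<rbrakk> \<Longrightarrow> x = y"
  using gen_lcm[of x s y s] by (cases s) auto

lemma cancel_cls: "\<lbrakk>ok (x * cls u); x * cls u = y * cls u\<rbrakk> \<Longrightarrow> x = y"
proof (induction u rule: rev_induct)
  case (snoc s u)
  have "x * cls u * gen s = y * cls u * gen s" "ok (x * cls u * gen s)"
    using snoc.prems by (simp_all add: mult.assoc)
  then have "x * cls u = y * cls u" "ok (x * cls u)"
    using cancel_gen okD by blast+
  then show ?case using snoc.IH by blast
qed simp

lemma lcm_sg_far:
  assumes "ok (x * sg j)" "x * sg j = y * sg k" "far j k"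
  obtains q where "x = q * sg k" "y = q * sg j"
  using gen_lcm[OF assms(1,2)] assms(3) by (auto simp: cpl_sig far_sym simp del: cpl.simps)

lemma lcm_sg_adj:
  assumes "ok (x * sg j)" "x * sg j = y * sg k" "adj j k"
  obtains q where "x = q * sg j * sg k" "y = q * sg k * sg j"
  using gen_lcm[OF assms(1,2)] assms(3)
  by (auto simp: cpl_sig adj_sym simp del: cpl.simps simp flip: mult.assoc)

lemma lcm_sg_al:
  assumes "ok (x * sg k)" "x * sg k = y * al i"
  obtains q where "x = q * al (switch k i)" "y = q * cab i k"
  using gen_lcm[OF assms] by (auto simp: cab_def)

lemma lcm_al_al:
  assumes "ok (x * al i)" "x * al i = y * al j" "i \<noteq> j"
  obtains q where "x = q * al (bump i j)" "y = q * al (bump j i)"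
  using gen_lcm[OF assms(1,2)] assms(3) by auto

lemma lcm_sg_far2:
  assumes "ok (p * sg m)" "p * sg m = w * sg x * sg y" "far m x" "far m y"
  obtains q where "p = q * sg x * sg y" "w = q * sg m"
proof -
  obtain q1 where q1: "p = q1 * sg y" "w * sg x = q1 * sg m"
    using assms by (elim lcm_sg_far)
  have "ok (q1 * sg m)"
    using assms(1) q1(1) okD sg_far[OF assms(4)] by (metis mult.assoc)
  then obtain q2 where "q1 = q2 * sg x" "w = q2 * sg m"
    using q1(2)[symmetric] assms(3) by (elim lcm_sg_far)
  then show ?thesis using that q1(1) by blast
qed

text \<open>A converse of \<open>cab_far\<close>: below the bound, every equality between left
  multiples of the two cables comes from it.\<close>

lemma lcm_cab_far:
  assumes "ok (p * cab i k)" "p * cab i k = w * cab i j" "far j k"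
  obtains q where "p = q * cab (switch k i) j" "w = q * cab (switch j i) k"
proof -
  have *: "\<exists>q. p = q * cab (switch k i) j \<and> w = q * cab (switch j i) k"
    if ok: "ok (p * cab i k)" and eq: "p * cab i k = w * cab i j" and jk: "Suc j < k" for j k p w
  proof -
    consider "i < j" | "i = j" | "i = Suc j" | "Suc j < i" "i < k" | "i = k" | "i = Suc k" | "Suc k < i"
      by linarith
    then show ?thesis
    proof cases
      case 1
      then have "ok (p * sg (Suc k))" "p * sg (Suc k) = w * sg (Suc j)"
        using ok eq jk by (simp_all add: cab_cases)
      then obtain q where "p = q * sg (Suc j)" "w = q * sg (Suc k)"
        by (rule lcm_sg_far) (use jk in \<open>simp add: far_def\<close>)
      then show ?thesis using 1 jk by (auto simp: cab_cases switch_cases)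
    next
      case 2
      then have "ok (p * sg (Suc k))" "p * sg (Suc k) = w * sg j * sg (Suc j)"
        using ok eq jk by (simp_all add: cab_cases mult.assoc)
      then obtain q where "p = q * sg j * sg (Suc j)" "w = q * sg (Suc k)"
        by (rule lcm_sg_far2) (use jk in \<open>simp_all add: far_def\<close>)
      then show ?thesis using 2 jk by (auto simp: cab_cases switch_cases mult.assoc)
    next
      case 3
      then have "ok (p * sg (Suc k))" "p * sg (Suc k) = w * sg (Suc j) * sg j"
        using ok eq jk by (simp_all add: cab_cases mult.assoc)
      then obtain q where "p = q * sg (Suc j) * sg j" "w = q * sg (Suc k)"
        by (rule lcm_sg_far2) (use jk in \<open>simp_all add: far_def\<close>)
      then show ?thesis using 3 jk by (auto simp: cab_cases switch_cases mult.assoc)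
    next
      case 4
      then have "ok (p * sg (Suc k))" "p * sg (Suc k) = w * sg j"
        using ok eq jk by (simp_all add: cab_cases)
      then obtain q where "p = q * sg j" "w = q * sg (Suc k)"
        by (rule lcm_sg_far) (use jk in \<open>simp add: far_def\<close>)
      then show ?thesis using 4 jk by (auto simp: cab_cases switch_cases)
    next
      case 5
      then have "ok (w * sg j)" "w * sg j = p * sg k * sg (Suc k)"
        using ok eq jk by (simp_all add: cab_cases mult.assoc)
      then obtain q where "w = q * sg k * sg (Suc k)" "p = q * sg j"
        by (rule lcm_sg_far2) (use jk in \<open>simp_all add: far_def\<close>)
      then show ?thesis using 5 jk by (auto simp: cab_cases switch_cases mult.assoc)
    next
      case 6
      then have "ok (w * sg j)" "w * sg j = p * sg (Suc k) * sg k"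
        using ok eq jk by (simp_all add: cab_cases mult.assoc)
      then obtain q where "w = q * sg (Suc k) * sg k" "p = q * sg j"
        by (rule lcm_sg_far2) (use jk in \<open>simp_all add: far_def\<close>)
      then show ?thesis using 6 jk by (auto simp: cab_cases switch_cases mult.assoc)
    next
      case 7
      then have "ok (p * sg k)" "p * sg k = w * sg j"
        using ok eq jk by (simp_all add: cab_cases)
      then obtain q where "p = q * sg j" "w = q * sg k"
        by (rule lcm_sg_far) (use jk in \<open>simp add: far_def\<close>)
      then show ?thesis using 7 jk by (auto simp: cab_cases switch_cases)
    qed
  qed
  have ok': "ok (w * cab i j)" using assms(1,2) by simp
  from assms(3) consider "Suc j < k" | "Suc k < j" unfolding far_def by blast
  then show ?thesis
  proof cases
    case 1
    show ?thesis using *[OF assms(1,2) 1] that by blast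
  next
    case 2
    show ?thesis using *[OF ok' assms(2)[symmetric] 2] that by blast
  qed
qed

text \<open>The converse of \<open>cab_adj\<close>. When the doubled strand passes through a
  crossing, its cable has two letters, and the quotient is found by resolving one letter after the
  other.\<close>

lemma lcm_cab_adj:
  assumes "ok (p * cab i k)" "p * cab i k = w * cab i j" "adj j k"
  obtains q where "p = q * cab (switch j (switch k i)) k * cab (switch k i) j"
    "w = q * cab (switch k (switch j i)) j * cab (switch j i) k"
proof -
  have *: "\<exists>q. p = q * cab (switch j (switch k i)) k * cab (switch k i) j
      \<and> w = q * cab (switch k (switch j i)) j * cab (switch j i) k"
    if ok: "ok (p * cab i k)" and eq: "p * cab i k = w * cab i j" and jk: "k = Suc j" for j k p w
  proof -
    let ?a = "sg j" and ?b = "sg (Suc j)" and ?c = "sg (Suc (Suc j))"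
    have nbr: "adj j (Suc j)" "adj (Suc j) (Suc (Suc j))" "far j (Suc (Suc j))"
      by (simp_all add: adj_def far_def)
    note nbr' = nbr(1,2)[THEN adj_sym] nbr(3)[THEN far_sym]
    consider "i < j" | "i = j" | "i = Suc j" | "i = Suc (Suc j)" | "Suc (Suc j) < i"
      by linarith
    then show ?thesis
    proof cases
      case 1
      then have "p * ?c = w * ?b" "ok (p * ?c)"
        using ok eq jk by (simp_all add: cab_cases)
      then obtain q where "p = q * ?c * ?b" "w = q * ?b * ?c"
        using nbr' by (elim lcm_sg_adj)
      then show ?thesis using 1 jk by (auto simp: cab_cases switch_cases)
    next
      case 2
      then have "p * ?c = (w * ?a) * ?b" "ok (p * ?c)"
        using ok eq jk by (simp_all add: cab_cases mult.assoc)
      then obtain q1 where q1: "p = q1 * ?c * ?b" "w * ?a = q1 * ?b * ?c"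
        using nbr' by (elim lcm_sg_adj)
      \<comment> \<open>\<open>p * ?c\<close> equals
        \<open>q1 * ?c * ?b * ?c = q1 * ?b * ?c * ?b\<close>, so the bound passes to this left
        factor.\<close>
      have "ok (q1 * ?b * ?c)"
        using \<open>ok (p * ?c)\<close> okD q1 by (metis mult.assoc nbr sg_adj')
      then obtain q2 where q2: "q1 * ?b = q2 * ?a" "w = q2 * ?c"
        using q1(2)[symmetric] nbr' by (elim lcm_sg_far)
      have "ok (q1 * ?b)" using \<open>ok (q1 * ?b * ?c)\<close> by (rule okD)
      then obtain q3 where q3: "q1 = q3 * ?b * ?a" "q2 = q3 * ?a * ?b"
        using q2(1) nbr' by (elim lcm_sg_adj)
      have "p = q3 * (?b * ?c) * (?a * ?b)"
        using q1(1) q3(1) sg_far'[OF nbr(3), of "q3 * ?b"] by (simp flip: mult.assoc)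
      then show ?thesis
        using 2 jk q2(2) q3(2) by (auto simp: cab_cases switch_cases mult.assoc)
    next
      case 3
      then have "(p * ?b) * ?c = (w * ?b) * ?a" and ok1: "ok (p * ?b * ?c)"
        using ok eq jk by (simp_all add: cab_cases mult.assoc)
      then obtain q where q: "p * ?b = q * ?a" "w * ?b = q * ?c"
        using nbr' by (elim lcm_sg_far)
      have "ok (p * ?b)" "ok (w * ?b)"
        using ok1 okD \<open>(p * ?b) * ?c = (w * ?b) * ?a\<close> by metis+
      then obtain q2 q3 where q2: "p = q2 * ?b * ?a" "q = q2 * ?a * ?b"
        and q3: "w = q3 * ?b * ?c" "q = q3 * ?c * ?b"
        using q nbr nbr' lcm_sg_adj by metis
      have "ok (q2 * ?a * ?b)"
        using okD[of q ?a] q(1) q2(2) \<open>ok (p * ?b)\<close> by simp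
      \<comment> \<open>Both expressions for \<open>q\<close> end in \<open>?b\<close>, which can be
        cancelled below the bound.\<close>
      then have "q2 * ?a = q3 * ?c" "ok (q2 * ?a)"
        using q2(2) q3(2) cancel_gen okD by metis+
      then obtain q4 where "q2 = q4 * ?c" "q3 = q4 * ?a"
        using nbr by (elim lcm_sg_far)
      then show ?thesis
        using 3 jk q2(1) q3(1) by (auto simp: cab_cases switch_cases mult.assoc)
    next
      case 4
      then have "(p * ?c) * ?b = w * ?a" and ok1: "ok (p * ?c * ?b)"
        using ok eq jk by (simp_all add: cab_cases mult.assoc)
      then obtain q1 where q1: "p * ?c = q1 * ?b * ?a" "w = q1 * ?a * ?b"
        using nbr' by (elim lcm_sg_adj)
      have "ok (p * ?c)" using ok1 by (rule okD)
      then obtain q2 where q2: "q1 * ?b = q2 * ?c" "p = q2 * ?a"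
        using q1(1) nbr' by (metis lcm_sg_far)
      have "ok (q1 * ?b)" using okD[of "q1 * ?b" ?a] q1(1) \<open>ok (p * ?c)\<close> by simp
      then obtain q3 where q3: "q1 = q3 * ?b * ?c" "q2 = q3 * ?c * ?b"
        using q2(1) nbr by (elim lcm_sg_adj)
      have "w = q3 * (?b * ?a) * (?c * ?b)"
        using q1(2) q3(1) sg_far'[OF nbr(3), of "q3 * ?b"] by (simp flip: mult.assoc)
      then show ?thesis
        using 4 jk q2(2) q3(2) by (auto simp: cab_cases switch_cases mult.assoc)
    next
      case 5
      then have "p * ?b = w * ?a" "ok (p * ?b)"
        using ok eq jk by (simp_all add: cab_cases)
      then obtain q where "p = q * ?b * ?a" "w = q * ?a * ?b"
        using nbr' by (elim lcm_sg_adj)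
      then show ?thesis using 5 jk by (auto simp: cab_cases switch_cases)
    qed
  qed
  have ok': "ok (w * cab i j)" using assms(1,2) by simp
  from assms(3) consider "k = Suc j" | "j = Suc k" unfolding adj_def by blast
  then show ?thesis
  proof cases
    case 1
    show ?thesis using *[OF assms(1,2) 1] that by blast
  next
    case 2
    show ?thesis using *[OF ok' assms(2)[symmetric] 2] that by blast
  qed
qed

text \<open>Induction from the right end of \<open>u\<close>: each crossing turns into its cable
  while the joining letter moves left, until it arrives where the strand begins.\<close>

lemma lcm_sgs_al:
  assumes "ok (p * sgs u)" "p * sgs u = w * al x"
  shows "\<exists>q. p = q * al (switchs u x) \<and> w = q * cabs x u"
  using assms
proof (induction u arbitrary: w x rule: rev_induct)
  case (snoc k u)
  have "p * sgs u * sg k = w * al x" "ok (p * sgs u * sg k)"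
    using snoc.prems by (simp_all add: mult.assoc)
  then obtain q where q: "p * sgs u = q * al (switch k x)" "w = q * cab x k"
    by (elim lcm_sg_al)
  have "ok (p * sgs u)" using \<open>ok (p * sgs u * sg k)\<close> by (rule okD)
  from snoc.IH[OF this q(1)] show ?case
    using q(2) by (auto simp: switchs_append cabs_append mult.assoc)
qed auto

text \<open>What is needed to compose \<open>x s = z r\<close> and \<open>z r = y t\<close>: the quotients obtained from these two
  equalities agree on \<open>z\<close>, and must combine to a quotient for \<open>s\<close> and \<open>t\<close>.\<close>

definition cube :: "letter \<Rightarrow> letter \<Rightarrow> letter \<Rightarrow> bool"
  where "cube r s t \<longleftrightarrow> (\<forall>p w. ok (p * cls (cpl r t)) \<longrightarrow>
    p * cls (cpl r t) = w * cls (cpl r s) \<longrightarrow>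
    (\<exists>q. w * cls (cpl s r) = q * cls (cpl s t) \<and> p * cls (cpl t r) = q * cls (cpl t s)))"

section \<open>The cube condition for every type of triple\<close>

lemma cube_sym: "cube r s t \<Longrightarrow> cube r t s"
  unfolding cube_def by metis

lemma cpl_self [simp]: "cpl s s = []"
  by (cases s) auto

lemma cube_trivial: "cube r s s" "cube r r t"
proof -
  show "cube r s s"
    unfolding cube_def using cancel_cls by fastforce
  show "cube r r t"
    unfolding cube_def by auto
qed

text \<open>The cases are the positions of \<open>i\<close> relative to \<open>j\<close> and
  \<open>k\<close>. When the three crossings are consecutive (in \<open>af\<close> under
  \<open>adj\<close>, and in \<open>aa\<close>), the equalities lead to a left multiple of the half
  twist on four strands.\<close>

lemma cube_sig: "cube (Sig i) (Sig j) (Sig k)"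
proof -
  let ?r = "sg i" and ?s = "sg j" and ?t = "sg k"
  have ff: "cube (Sig i) (Sig j) (Sig k)" if rs: "far i j" and rt: "far i k" for j k
  proof (cases j k rule: cases_adj_far)
    case eq
    then show ?thesis by (simp add: cube_trivial)
  next
    case adj
    show ?thesis
      unfolding cube_def
    proof (intro allI impI)
      fix p w
      let ?s = "sg j" and ?t = "sg k"
      assume "ok (p * cls (cpl (Sig i) (Sig k)))"
        "p * cls (cpl (Sig i) (Sig k)) = w * cls (cpl (Sig i) (Sig j))"
      then have "ok (p * ?t)" "p * ?t = w * ?s"
        using rs rt by (simp_all add: cpl_sig del: cpl.simps)
      then obtain q where q: "p = q * ?t * ?s" "w = q * ?s * ?t"
        using adj_sym[OF adj] by (elim lcm_sg_adj)
      have "w * ?r = q * ?r * ?s * ?t" "p * ?r = q * ?r * ?t * ?s"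
        unfolding q by (metis mult.assoc sg_far rs rt)+
      then show "\<exists>q. w * cls (cpl (Sig j) (Sig i)) = q * cls (cpl (Sig j) (Sig k)) \<and>
          p * cls (cpl (Sig k) (Sig i)) = q * cls (cpl (Sig k) (Sig j))"
        using rs rt adj
        by (intro exI[of _ "q * ?r"])
          (simp add: cpl_sig far_sym adj_sym mult.assoc del: cpl.simps)
    qed
  next
    case far
    show ?thesis
      unfolding cube_def
    proof (intro allI impI)
      fix p w
      let ?s = "sg j" and ?t = "sg k"
      assume "ok (p * cls (cpl (Sig i) (Sig k)))"
        "p * cls (cpl (Sig i) (Sig k)) = w * cls (cpl (Sig i) (Sig j))"
      then have "ok (p * ?t)" "p * ?t = w * ?s"
        using rs rt by (simp_all add: cpl_sig del: cpl.simps)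
      then obtain q where q: "p = q * ?s" "w = q * ?t"
        using far_sym[OF far] by (elim lcm_sg_far)
      have "w * ?r = q * ?r * ?t" "p * ?r = q * ?r * ?s"
        unfolding q by (metis mult.assoc sg_far rs rt)+
      then show "\<exists>q. w * cls (cpl (Sig j) (Sig i)) = q * cls (cpl (Sig j) (Sig k)) \<and>
          p * cls (cpl (Sig k) (Sig i)) = q * cls (cpl (Sig k) (Sig j))"
        using rs rt far
        by (intro exI[of _ "q * ?r"])
          (simp add: cpl_sig far_sym adj_sym mult.assoc del: cpl.simps)
    qed
  qed
  have af: "cube (Sig i) (Sig j) (Sig k)" if rs: "adj i j" and rt: "far i k" for j k
  proof (cases j k rule: cases_adj_far)
    case eq
    then show ?thesis by (simp add: cube_trivial)
  next
    case adj
    show ?thesis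
      unfolding cube_def
    proof (intro allI impI)
      fix p w
      let ?s = "sg j" and ?t = "sg k"
      assume "ok (p * cls (cpl (Sig i) (Sig k)))"
        "p * cls (cpl (Sig i) (Sig k)) = w * cls (cpl (Sig i) (Sig j))"
      then have ok: "ok (p * ?t)" and "p * ?t = (w * ?r) * ?s"
        using rs rt by (simp_all add: cpl_sig mult.assoc del: cpl.simps)
      then obtain q where q: "p = q * ?t * ?s" "w * ?r = q * ?s * ?t"
        using adj_sym[OF adj] by (elim lcm_sg_adj)
      have "ok (q * ?s * ?t)"
        using ok okD[of "q * ?s * ?t" ?s] sg_adj'[OF adj, of q] q(1) by simp
      then obtain q1 where q1: "q * ?s = q1 * ?r" "w = q1 * ?t"
        using q(2)[symmetric] far_sym[OF rt] by (elim lcm_sg_far)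
      have "ok (q * ?s)" using \<open>ok (q * ?s * ?t)\<close> by (rule okD)
      then obtain q2 where q2: "q = q2 * ?s * ?r" "q1 = q2 * ?r * ?s"
        using q1(1) adj_sym[OF rs] by (elim lcm_sg_adj)
      have "w * ?s * ?r = q2 * ?r * ?s * ?t * ?s * ?r"
        using q1(2) q2(2) by simp
      also have "\<dots> = q2 * ?r * ?t * ?s * ?t * ?r"
        by (metis sg_adj'[OF adj])
      also have "\<dots> = q2 * ?r * ?t * ?s * ?r * ?t"
        by (metis sg_far'[OF rt])
      also have "\<dots> = q2 * ?t * ?r * ?s * ?r * ?t"
        by (metis sg_far'[OF rt])
      also have "\<dots> = q2 * ?t * ?s * ?r * ?s * ?t"
        by (metis sg_adj'[OF rs])
      finally have 1: "w * ?s * ?r = q2 * ?t * ?s * ?r * ?s * ?t" .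
      have "p * ?r = q2 * ?s * ?r * ?t * ?s * ?r"
        using q(1) q2(1) by simp
      also have "\<dots> = q2 * ?s * ?t * ?r * ?s * ?r"
        by (metis sg_far'[OF rt])
      also have "\<dots> = q2 * ?s * ?t * ?s * ?r * ?s"
        by (metis sg_adj'[OF rs])
      also have "\<dots> = q2 * ?t * ?s * ?t * ?r * ?s"
        by (metis sg_adj'[OF adj])
      also have "\<dots> = q2 * ?t * ?s * ?r * ?t * ?s"
        by (metis sg_far'[OF rt])
      finally have 2: "p * ?r = q2 * ?t * ?s * ?r * ?t * ?s" .
      show "\<exists>q. w * cls (cpl (Sig j) (Sig i)) = q * cls (cpl (Sig j) (Sig k)) \<and>
          p * cls (cpl (Sig k) (Sig i)) = q * cls (cpl (Sig k) (Sig j))"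
        using rs rt adj 1 2
        by (intro exI[of _ "q2 * ?t * ?s * ?r"])
          (simp add: cpl_sig far_sym adj_sym mult.assoc del: cpl.simps)
    qed
  next
    case far
    show ?thesis
      unfolding cube_def
    proof (intro allI impI)
      fix p w
      let ?s = "sg j" and ?t = "sg k"
      assume "ok (p * cls (cpl (Sig i) (Sig k)))"
        "p * cls (cpl (Sig i) (Sig k)) = w * cls (cpl (Sig i) (Sig j))"
      then have ok: "ok (p * ?t)" and "p * ?t = w * ?r * ?s"
        using rs rt by (simp_all add: cpl_sig mult.assoc del: cpl.simps)
      then obtain q where q: "p = q * ?r * ?s" "w = q * ?t"
        using far_sym[OF far] far_sym[OF rt] by (elim lcm_sg_far2)
      have "w * ?s * ?r = q * ?s * ?r * ?t"
        unfolding q by (metis sg_far' rt far)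
      moreover have "p * ?r = q * ?s * ?r * ?s"
        unfolding q by (metis sg_adj' rs)
      ultimately show "\<exists>q. w * cls (cpl (Sig j) (Sig i)) = q * cls (cpl (Sig j) (Sig k)) \<and>
          p * cls (cpl (Sig k) (Sig i)) = q * cls (cpl (Sig k) (Sig j))"
        using rs rt far
        by (intro exI[of _ "q * ?s * ?r"])
          (simp add: cpl_sig far_sym adj_sym mult.assoc del: cpl.simps)
    qed
  qed
  have aa: "cube (Sig i) (Sig j) (Sig k)" if rs: "adj i j" and rt: "adj i k" and ne: "j \<noteq> k"
  proof -
    \<comment> \<open>\<open>j\<close> and \<open>k\<close> are the two different neighbours of
      \<open>i\<close>.\<close>
    have st: "far j k" using rs rt ne by (auto simp: adj_def far_def)
    show ?thesis
      unfolding cube_def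
    proof (intro allI impI)
      fix p w
      assume "ok (p * cls (cpl (Sig i) (Sig k)))"
        "p * cls (cpl (Sig i) (Sig k)) = w * cls (cpl (Sig i) (Sig j))"
      then have ok: "ok (p * ?r * ?t)" and eq: "(p * ?r) * ?t = (w * ?r) * ?s"
        using rs rt by (simp_all add: cpl_sig mult.assoc del: cpl.simps)
      then obtain q where q: "p * ?r = q * ?s" "w * ?r = q * ?t"
        using far_sym[OF st] by (elim lcm_sg_far)
      have ok2: "ok (p * ?r)" "ok (w * ?r)"
        using ok okD eq by metis+
      obtain q1 where q1: "p = q1 * ?r * ?s" "q = q1 * ?s * ?r"
        using ok2(1) q(1) rs by (elim lcm_sg_adj)
      obtain q2 where q2: "w = q2 * ?r * ?t" "q = q2 * ?t * ?r"
        using ok2(2) q(2) rt by (elim lcm_sg_adj)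
      have "ok (q1 * ?s * ?r)"
        using okD[of q ?s] ok2(1) q(1) q1(2) by simp
      then have "q1 * ?s = q2 * ?t" "ok (q1 * ?s)"
        using q1(2) q2(2) cancel_gen okD by metis+
      then obtain q3 where q3: "q1 = q3 * ?t" "q2 = q3 * ?s"
        using st by (elim lcm_sg_far)
      have "w * ?s * ?r = q3 * ?s * ?r * ?t * ?s * ?r"
        using q2(1) q3(2) by simp
      also have "\<dots> = q3 * ?s * ?r * ?s * ?t * ?r"
        by (metis sg_far'[OF st])
      also have "\<dots> = q3 * ?r * ?s * ?r * ?t * ?r"
        by (metis sg_adj'[OF rs])
      also have "\<dots> = q3 * ?r * ?s * ?t * ?r * ?t"
        by (metis sg_adj'[OF rt])
      finally have 1: "w * ?s * ?r = q3 * ?r * ?s * ?t * ?r * ?t" .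
      have "p * ?t * ?r = q3 * ?t * ?r * ?s * ?t * ?r"
        using q1(1) q3(1) by simp
      also have "\<dots> = q3 * ?t * ?r * ?t * ?s * ?r"
        by (metis sg_far'[OF st])
      also have "\<dots> = q3 * ?r * ?t * ?r * ?s * ?r"
        by (metis sg_adj'[OF rt])
      also have "\<dots> = q3 * ?r * ?t * ?s * ?r * ?s"
        by (metis sg_adj'[OF rs])
      also have "\<dots> = q3 * ?r * ?s * ?t * ?r * ?s"
        by (metis sg_far'[OF st])
      finally have 2: "p * ?t * ?r = q3 * ?r * ?s * ?t * ?r * ?s" .
      show "\<exists>q. w * cls (cpl (Sig j) (Sig i)) = q * cls (cpl (Sig j) (Sig k)) \<and>
          p * cls (cpl (Sig k) (Sig i)) = q * cls (cpl (Sig k) (Sig j))"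
        using rs rt st 1 2
        by (intro exI[of _ "q3 * ?r * ?s * ?t * ?r"])
          (simp add: cpl_sig far_sym adj_sym mult.assoc del: cpl.simps)
    qed
  qed
  consider "i = j" | "i = k" | "j = k" | "far i j" "far i k" | "adj i j" "far i k"
    | "far i j" "adj i k" | "adj i j" "adj i k" "j \<noteq> k"
    using cases_adj_far by metis
  then show ?thesis
    by cases (use cube_trivial cube_sym ff af aa in blast)+
qed

text \<open>The equality between cables is resolved by \<open>lcm_cab_adj\<close> or
  \<open>lcm_cab_far\<close>; then \<open>al_sg'\<close> pushes the joining letter to the left and
  turns the cables back into single crossings.\<close>

lemma cube_al_sig_sig: "cube (Let i) (Sig j) (Sig k)"
proof (cases j k rule: cases_adj_far)
  case eq
  then show ?thesis by (simp add: cube_trivial)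
next
  case adj
  show ?thesis
    unfolding cube_def
  proof (intro allI impI)
    fix p w
    assume "ok (p * cls (cpl (Let i) (Sig k)))"
      "p * cls (cpl (Let i) (Sig k)) = w * cls (cpl (Let i) (Sig j))"
    then obtain q where q: "p = q * cab (switch j (switch k i)) k * cab (switch k i) j"
        "w = q * cab (switch k (switch j i)) j * cab (switch j i) k"
      using adj by (metis cpl.simps(3) cab_def lcm_cab_adj)
    have "w * al (switch j i) = q * al (switch j (switch k (switch j i))) * sg j * sg k"
      unfolding q by (simp only: al_sg' flip: mult.assoc)
    moreover have "p * al (switch k i) = q * al (switch k (switch j (switch k i))) * sg k * sg j"
      unfolding q by (simp only: al_sg' flip: mult.assoc)
    ultimately show "\<exists>q. w * cls (cpl (Sig j) (Let i)) = q * cls (cpl (Sig j) (Sig k)) \<and>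
        p * cls (cpl (Sig k) (Let i)) = q * cls (cpl (Sig k) (Sig j))"
      using adj switch_adj[OF adj]
      by (intro exI[of _ "q * al (switch j (switch k (switch j i)))"])
        (simp add: cpl_sig adj_sym mult.assoc del: cpl.simps(1))
  qed
next
  case far
  show ?thesis
    unfolding cube_def
  proof (intro allI impI)
    fix p w
    assume "ok (p * cls (cpl (Let i) (Sig k)))"
      "p * cls (cpl (Let i) (Sig k)) = w * cls (cpl (Let i) (Sig j))"
    then obtain q where q: "p = q * cab (switch k i) j" "w = q * cab (switch j i) k"
      using far by (metis cpl.simps(3) cab_def lcm_cab_far)
    have "w * al (switch j i) = q * al (switch k (switch j i)) * sg k"
      "p * al (switch k i) = q * al (switch j (switch k i)) * sg j"
      unfolding q by (simp_all add: al_sg')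
    then show "\<exists>q. w * cls (cpl (Sig j) (Let i)) = q * cls (cpl (Sig j) (Sig k)) \<and>
        p * cls (cpl (Sig k) (Let i)) = q * cls (cpl (Sig k) (Sig j))"
      using far switch_far[OF far]
      by (intro exI[of _ "q * al (switch k (switch j i))"])
        (simp add: cpl_sig far_sym del: cpl.simps(1))
  qed
qed

text \<open>Here the joining letter is extracted from \<open>w\<close> through the crossings, and
  \<open>cab_adj\<close> or \<open>cab_far\<close> compares the cables left behind.\<close>

lemma cube_sig_sig_al: "cube (Sig k) (Sig j) (Let i)"
proof (cases j k rule: cases_adj_far)
  case eq
  then show ?thesis by (simp add: cube_trivial)
next
  case adj
  show ?thesis
    unfolding cube_def
  proof (intro allI impI)
    fix p w
    assume "ok (p * cls (cpl (Sig k) (Let i)))"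
      "p * cls (cpl (Sig k) (Let i)) = w * cls (cpl (Sig k) (Sig j))"
    then have ok: "ok (w * sg k * sg j)" and eq: "w * sg k * sg j = p * al (switch k i)"
      using adj by (simp_all add: cpl_sig adj_sym mult.assoc del: cpl.simps(1))
    from ok eq obtain q1 where q1: "w * sg k = q1 * al (switch j (switch k i))" "p = q1 * cab (switch k i) j"
      by (elim lcm_sg_al)
    from okD[OF ok] q1(1) obtain q where q: "w = q * al (switch k (switch j (switch k i)))"
        "q1 = q * cab (switch j (switch k i)) k"
      by (elim lcm_sg_al)
    have "w * sg j * sg k = q * cab (switch k (switch j i)) j * cab (switch j i) k * al (switch j i)"
      unfolding q by (simp add: switch_adj[OF adj, symmetric] al_sg')
    moreover have "p * cab i k = q * cab (switch k (switch j i)) j * cab (switch j i) k * cab i j"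
      unfolding q1 q using cab_adj[OF adj, of i] by (simp add: mult.assoc)
    ultimately show "\<exists>q. w * cls (cpl (Sig j) (Sig k)) = q * cls (cpl (Sig j) (Let i)) \<and>
        p * cls (cpl (Let i) (Sig k)) = q * cls (cpl (Let i) (Sig j))"
      using adj
      by (intro exI[of _ "q * cab (switch k (switch j i)) j * cab (switch j i) k"])
        (simp add: cpl_sig cab_def mult.assoc del: cpl.simps(1))
  qed
next
  case far
  show ?thesis
    unfolding cube_def
  proof (intro allI impI)
    fix p w
    assume "ok (p * cls (cpl (Sig k) (Let i)))"
      "p * cls (cpl (Sig k) (Let i)) = w * cls (cpl (Sig k) (Sig j))"
    then have "ok (w * sg j)" "w * sg j = p * al (switch k i)"
      using far by (simp_all add: cpl_sig far_sym del: cpl.simps(1))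
    then obtain q where q: "w = q * al (switch j (switch k i))" "p = q * cab (switch k i) j"
      by (elim lcm_sg_al)
    have "w * sg k = q * cab (switch j i) k * al (switch j i)"
      unfolding q by (simp add: switch_far[OF far] al_sg')
    moreover have "p * cab i k = q * cab (switch j i) k * cab i j"
      unfolding q using cab_far[OF far, of i] by (simp add: mult.assoc)
    ultimately show "\<exists>q. w * cls (cpl (Sig j) (Sig k)) = q * cls (cpl (Sig j) (Let i)) \<and>
        p * cls (cpl (Let i) (Sig k)) = q * cls (cpl (Let i) (Sig j))"
      using far by (intro exI[of _ "q * cab (switch j i) k"])
        (simp add: cpl_sig cab_def del: cpl.simps(1))
  qed
qed

text \<open>\<open>lcm_sgs_al\<close> describes \<open>w\<close> with the strands doubled in one
  order, \<open>al_sgs\<close> needs the other order; \<open>cabs_cable\<close> identifies the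
  two.\<close>

lemma cube_al_al_sig: "cube (Let i) (Let j) (Sig k)"
proof (cases "i = j")
  case True
  then show ?thesis by (simp add: cube_trivial)
next
  case False
  show ?thesis
    unfolding cube_def
  proof (intro allI impI)
    fix p w
    assume "ok (p * cls (cpl (Let i) (Sig k)))"
      "p * cls (cpl (Let i) (Sig k)) = w * cls (cpl (Let i) (Let j))"
    then have "ok (p * sgs (cable_ind i k))" "p * sgs (cable_ind i k) = w * al (bump i j)"
      using False by (simp_all add: cable_ind)
    from lcm_sgs_al[OF this] obtain q where q: "p = q * al (bump (switch k i) (switch k j))"
        "w = q * cabs (bump j i) (cable_ind j k)"
      using False by (auto simp: switchs_cable cabs_cable)
    have ne: "switch k i \<noteq> switch k j" using False by (auto simp: switch_def split: if_splits)
    have "w * al (bump j i) = q * al (bump (switch k j) (switch k i)) * cab j k"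
      unfolding q using al_sgs[of "cable_ind j k" "bump j i"] False
      by (simp add: switchs_cable sgs_cable_ind mult.assoc)
    moreover have "p * al (switch k i) = q * al (bump (switch k j) (switch k i)) * al (switch k j)"
      unfolding q by (rule al_al'[OF ne])
    ultimately show "\<exists>q. w * cls (cpl (Let j) (Let i)) = q * cls (cpl (Let j) (Sig k)) \<and>
        p * cls (cpl (Sig k) (Let i)) = q * cls (cpl (Sig k) (Let j))"
      using False by (intro exI[of _ "q * al (bump (switch k j) (switch k i))"]) (simp add: cab_def)
  qed
qed

lemma cube_sig_al_al: "cube (Sig k) (Let i) (Let j)"
proof (cases "i = j")
  case True
  then show ?thesis by (simp add: cube_trivial)
next
  case False
  then have ne: "switch k j \<noteq> switch k i" by (auto simp: switch_def split: if_splits)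
  show ?thesis
    unfolding cube_def
  proof (intro allI impI)
    fix p w
    assume "ok (p * cls (cpl (Sig k) (Let j)))"
      "p * cls (cpl (Sig k) (Let j)) = w * cls (cpl (Sig k) (Let i))"
    then have "ok (p * al (switch k j))" "p * al (switch k j) = w * al (switch k i)" by simp_all
    then obtain q where q: "p = q * al (bump (switch k j) (switch k i))" "w = q * al (bump (switch k i) (switch k j))"
      using ne by (elim lcm_al_al)
    have "w * cab i k = q * cabs (bump i j) (cable_ind i k) * al (bump i j)"
      unfolding q using al_sgs[of "cable_ind i k" "bump i j"] False
      by (simp add: switchs_cable sgs_cable_ind mult.assoc)
    moreover have "p * cab j k = q * cabs (bump i j) (cable_ind i k) * al (bump j i)"
      unfolding q using al_sgs[of "cable_ind j k" "bump j i"] False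
      by (simp add: switchs_cable sgs_cable_ind cabs_cable mult.assoc)
    ultimately show "\<exists>q. w * cls (cpl (Let i) (Sig k)) = q * cls (cpl (Let i) (Let j)) \<and>
        p * cls (cpl (Let j) (Sig k)) = q * cls (cpl (Let j) (Let i))"
      using False by (intro exI[of _ "q * cabs (bump i j) (cable_ind i k)"]) (simp add: cab_def)
  qed
qed

lemma cube_al: "cube (Let i) (Let j) (Let k)"
proof (cases "i = j \<or> i = k \<or> j = k")
  case True
  then show ?thesis using cube_trivial cube_sym by blast
next
  case False
  show ?thesis
    unfolding cube_def
  proof (intro allI impI)
    fix p w
    assume "ok (p * cls (cpl (Let i) (Let k)))"
      "p * cls (cpl (Let i) (Let k)) = w * cls (cpl (Let i) (Let j))"
    then have "ok (p * al (bump i k))" "p * al (bump i k) = w * al (bump i j)"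
      using False by simp_all
    then obtain q where q: "p = q * al (bump (bump i k) (bump i j))"
        "w = q * al (bump (bump i j) (bump i k))"
      by (rule lcm_al_al) (use False in \<open>simp add: bump_bump\<close>)
    have "w * al (bump j i) = q * al (bump (bump j k) (bump j i)) * al (bump j k)"
      unfolding q using False bump_bump(1)[of i j k] by (simp add: al_al' bump_bump(2))
    moreover have "p * al (bump k i) = q * al (bump (bump j k) (bump j i)) * al (bump k j)"
      unfolding q using False al_al'[of "bump k i" "bump k j" q] bump_bump(1)[of i k j] bump_bump(1)[of k j i]
      by (simp add: bump_bump(2))
    ultimately show "\<exists>q. w * cls (cpl (Let j) (Let i)) = q * cls (cpl (Let j) (Let k)) \<and>
        p * cls (cpl (Let k) (Let i)) = q * cls (cpl (Let k) (Let j))"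
      using False by (intro exI[of _ "q * al (bump (bump j k) (bump j i))"]) simp
  qed
qed

lemma cube: "cube r s t"
  by (cases r; cases s; cases t)
    (simp_all add: cube_sig cube_al_sig_sig cube_sig_sig_al cube_al_al_sig cube_sig_al_al cube_al
      cube_sym[OF cube_sig_sig_al] cube_sym[OF cube_al_al_sig])

end

text \<open>The outer induction is on the weight, the inner one on the derivation of the congruence.
  Only transitivity needs the cube condition, for the last letter of the middle word; it concerns
  the middle word without this letter, whose weight is below \<open>N\<close>.\<close>

lemma gen_lcm:
  assumes "x * gen s = y * gen t"
  shows "\<exists>q. x = q * cls (cpl s t) \<and> y = q * cls (cpl t s)"
proof -
  define P where "P u v \<longleftrightarrow> (\<forall>a b s t. u = a @ [s] \<longrightarrow> v = b @ [t] \<longrightarrow>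
    (\<exists>q. cls a = q * cls (cpl s t) \<and> cls b = q * cls (cpl t s)))" for u v
  have main: "P u v" if "cong u v" "weight (cls u) = N" for u v N
    using that
  proof (induction N arbitrary: u v rule: less_induct)
    case (less N)
    interpret lcm_below N
    proof
      fix x y s t
      assume *: "weight (x * gen s) < N" "x * gen s = y * gen t"
      obtain a b where ab: "x = cls a" "y = cls b" by (meson cls_surj)
      have "cong (a @ [s]) (b @ [t])" using * ab by (simp flip: cls_eq)
      then have "P (a @ [s]) (b @ [t])" using less.IH * ab by simp
      then show "\<exists>q. x = q * cls (cpl s t) \<and> y = q * cls (cpl t s)"
        unfolding P_def ab by blast
    qed
    show ?case
      using less.prems
    proof (induction rule: cong_induct)
      case (refl u)
      then show ?case unfolding P_def by (auto intro: exI[of _ "cls _"])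
    next
      case (step u s t v)
      show ?case
      \<comment> \<open>If \<open>v\<close> is empty, the last letters are \<open>s\<close> and
        \<open>t\<close> and the quotient is \<open>cls u\<close>. Otherwise the last letters agree,
        and only the prefixes have to be compared.\<close>
      proof (cases v rule: rev_cases)
        case Nil
        then show ?thesis
          unfolding P_def by (auto simp flip: append_assoc)
      next
        case (snoc v' r)
        have "cls (u @ cpl s t @ s # v') = cls (u @ cpl t s @ t # v')"
          unfolding cls_append cls_Cons[of _ v'] using cpl_rel[of s t]
          by (metis mult.assoc)
        then show ?thesis
          unfolding P_def snoc by (auto intro!: exI[of _ "cls (u @ cpl s t @ s # v')"] simp del: cls_append)
      qed
    next
      case (sym u v)
      then have "P u v" using cls_eq by metis
      then show ?case unfolding P_def by metis
    next
      case (trans u v w)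
      have eq: "cls u = cls v" "cls v = cls w"
        using trans.hyps by (simp_all add: cls_eq)
      have Puv: "P u v" and Pvw: "P v w" using trans.IH trans.prems eq by simp_all
      show ?case
        unfolding P_def
      proof (intro allI impI)
        fix a b s t assume ua: "u = a @ [s]" and wb: "w = b @ [t]"
        \<comment> \<open>Positive weight excludes an empty middle word, so it has a last letter
          \<open>r\<close>.\<close>
        have "weight (cls v) > 0" using eq(1) weight_mult_gen_less[of "cls a" s] by (simp add: ua flip: eq)
        then have "v \<noteq> []" by (auto simp: weight_cls simp del: cls_Nil)
        then obtain c r where vc: "v = c @ [r]" by (metis rev_exhaust)
        obtain p where p: "cls a = p * cls (cpl s r)" "cls c = p * cls (cpl r s)"
          using Puv ua vc unfolding P_def by blast
        obtain q where q: "cls c = q * cls (cpl r t)" "cls b = q * cls (cpl t r)"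
          using Pvw vc wb unfolding P_def by blast
        have "weight (cls c) < N"
          using weight_mult_gen_less[of "cls c" r] eq vc trans.prems by simp
        then show "\<exists>q. cls a = q * cls (cpl s t) \<and> cls b = q * cls (cpl t s)"
          using cube[of r s t] p q unfolding cube_def by metis
      qed
    qed
  qed
  obtain a b where ab: "x = cls a" "y = cls b" by (meson cls_surj)
  have "cong (a @ [s]) (b @ [t])" using assms ab by (simp flip: cls_eq)
  then show ?thesis using main[OF _ HOL.refl] ab unfolding P_def by blast
qed

section \<open>Right cancellation and left lcms\<close>

lemma right_cancel_gen: "x * gen s = y * gen s \<Longrightarrow> x = y"
  using gen_lcm[of x s y s] by (cases s) auto

lemma right_cancel: "x * z = y * z \<Longrightarrow> x = (y :: bmon)"
proof (induction z rule: bmon_induct)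
  case (snoc z s)
  then have "x * z * gen s = y * z * gen s" by (simp add: mult.assoc)
  then show ?case using snoc.IH right_cancel_gen by blast
qed simp

definition rdiv :: "bmon \<Rightarrow> bmon \<Rightarrow> bool"
  where "rdiv x k \<longleftrightarrow> (\<exists>u. k = u * x)"

lemma rdiv_refl [simp]: "rdiv x x"
  unfolding rdiv_def by (metis mult_1)

lemma rdiv_one [simp]: "rdiv 1 x"
  unfolding rdiv_def by simp

lemma rdiv_mult [simp]: "rdiv x (u * x)"
  unfolding rdiv_def by blast

lemma rdiv_mult_cancel [simp]: "rdiv (x * z) (k * z) \<longleftrightarrow> rdiv x k"
  unfolding rdiv_def by (metis mult.assoc right_cancel)

text \<open>By \<open>gen_lcm\<close>, the last letters can be split off a common left multiple;
  this is the recursion for left lcms.\<close>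

lemma rdiv_gen_iff:
  "rdiv (x * gen s) h \<and> rdiv (y * gen t) h \<longleftrightarrow>
    (\<exists>q. h = q * cls (cpl s t) * gen s \<and> rdiv x (q * cls (cpl s t)) \<and> rdiv y (q * cls (cpl t s)))"
proof
  assume "rdiv (x * gen s) h \<and> rdiv (y * gen t) h"
  then obtain u v where uv: "h = u * x * gen s" "h = v * y * gen t"
    unfolding rdiv_def mult.assoc by blast
  then obtain q where "u * x = q * cls (cpl s t)" "v * y = q * cls (cpl t s)"
    using gen_lcm[of "u * x" s "v * y" t] by auto
  then show "\<exists>q. h = q * cls (cpl s t) * gen s \<and> rdiv x (q * cls (cpl s t))
      \<and> rdiv y (q * cls (cpl t s))"
    using uv by (metis rdiv_mult)
next
  assume "\<exists>q. h = q * cls (cpl s t) * gen s \<and> rdiv x (q * cls (cpl s t))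
      \<and> rdiv y (q * cls (cpl t s))"
  then obtain q where q: "h = q * cls (cpl s t) * gen s" "rdiv x (q * cls (cpl s t))"
      "rdiv y (q * cls (cpl t s))"
    by blast
  moreover have "h = q * cls (cpl t s) * gen t"
    using q(1) cpl_rel[of s t] by (simp add: mult.assoc)
  ultimately show "rdiv (x * gen s) h \<and> rdiv (y * gen t) h"
    by (metis rdiv_mult_cancel)
qed

lemma lcm_conditional:
  assumes "rdiv x k" "rdiv y k"
  shows "\<exists>m. \<forall>h. rdiv x h \<and> rdiv y h \<longleftrightarrow> rdiv m h"
  using assms
proof (induction "weight k" arbitrary: k x y rule: less_induct)
  case less
  show ?case
  proof (cases "x = 1 \<or> y = 1")
    case True
    then show ?thesis by (metis rdiv_one)
  next
    case False
    obtain x' s y' t where xy: "x = x' * gen s" "y = y' * gen t"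
      using False bmon_induct[of "\<lambda>z. z = 1 \<or> (\<exists>z' r. z = z' * gen r)"] by metis
    let ?st = "cls (cpl s t)" and ?ts = "cls (cpl t s)"
    obtain q where q: "k = q * ?st * gen s" "rdiv x' (q * ?st)" "rdiv y' (q * ?ts)"
      using less.prems rdiv_gen_iff[of x' s k y' t] unfolding xy by blast
    have k: "k = q * ?ts * gen t" using q(1) cpl_rel[of s t] by (simp add: mult.assoc)
    have w1: "weight (q * ?st) < weight k" unfolding q(1) by (rule weight_mult_gen_less)
    have w2: "weight (q * ?ts) < weight k" unfolding k by (rule weight_mult_gen_less)
    have w3: "weight q < weight k" using w1 weight_mult_ge[of q ?st] by simp
    \<comment> \<open>The lcm of \<open>x'\<close> and \<open>?st\<close> has the form
      \<open>p1 * ?st\<close>, and likewise for \<open>p2\<close>; the lcm of \<open>p1\<close> and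
      \<open>p2\<close> then yields that of \<open>x\<close> and \<open>y\<close>. Each of the three
      lcms has a common multiple lighter than \<open>k\<close>.\<close>
    obtain m1 where m1: "\<And>h. rdiv x' h \<and> rdiv ?st h \<longleftrightarrow> rdiv m1 h"
      using less.hyps[OF w1 q(2) rdiv_mult] by blast
    obtain m2 where m2: "\<And>h. rdiv y' h \<and> rdiv ?ts h \<longleftrightarrow> rdiv m2 h"
      using less.hyps[OF w2 q(3) rdiv_mult] by blast
    obtain p1 p2 where p: "m1 = p1 * ?st" "m2 = p2 * ?ts"
      using m1 m2 rdiv_refl unfolding rdiv_def by metis
    have p1: "rdiv x' (h * ?st) \<longleftrightarrow> rdiv p1 h" for h
      using m1[of "h * ?st"] by (simp add: p)
    have p2: "rdiv y' (h * ?ts) \<longleftrightarrow> rdiv p2 h" for h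
      using m2[of "h * ?ts"] by (simp add: p)
    obtain m where m: "\<And>h. rdiv p1 h \<and> rdiv p2 h \<longleftrightarrow> rdiv m h"
      using less.hyps[OF w3] q(2,3) p1 p2 by blast
    have "rdiv x h \<and> rdiv y h \<longleftrightarrow> rdiv (m * ?st * gen s) h" for h
      unfolding xy rdiv_gen_iff p1 p2 m unfolding rdiv_def by (metis mult.assoc)
    then show ?thesis by blast
  qed
qed

section \<open>Left cancellation\<close>

text \<open>Follows the strand that starts at position \<open>j\<close> and removes it from the word. When it is joined
  to another strand, that letter is dropped and the rest of the word is left unchanged.\<close>

fun delete :: "nat \<Rightarrow> letter list \<Rightarrow> bmon"
  where
    "delete j [] = 1"
  | "delete j (Sig k # w) =
      (if j = k then delete (Suc j) w else if j = Suc k then delete k w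
       else (if Suc k < j then sg k else sg (k - 1)) * delete j w)"
  | "delete j (Let k # w) =
      (if j = k \<or> j = Suc k then cls w
       else if Suc k < j then al k * delete (j - 1) w else al (k - 1) * delete j w)"

lemma al_sg_cases:
  "i < k \<Longrightarrow> al i * sg k = sg (Suc k) * al i"
  "al (Suc k) * sg k = sg k * sg (Suc k) * al k"
  "al k * sg k = sg (Suc k) * sg k * al (Suc k)"
  "Suc k < i \<Longrightarrow> al i * sg k = sg k * al i"
  using al_sg[of k i] al_sg[of k k] al_sg[of k "Suc k"] by (simp_all add: cab_cases switch_cases)

lemma al_al_less: "i < j \<Longrightarrow> al (Suc j) * al i = al i * al j"
  using al_al[of i j] by (simp add: bump_def)

text \<open>Cases on where the deleted strand begins. A strand that the relation does not touch
  leaves a relation, possibly shifted; a strand that it touches leaves two sides that agree.\<close>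

lemma delete_rel: "delete d (cpl s t @ s # v) = delete d (cpl t s @ t # v)"
proof -
  have ss: "delete d (cpl (Sig j) (Sig k) @ Sig j # v) = delete d (cpl (Sig k) (Sig j) @ Sig k # v)"
    if "j < k" for j k
  proof (cases "k = Suc j")
    case True
    have br: "sg n * sg (Suc n) * sg n = sg (Suc n) * sg n * sg (Suc n)" for n
      by (rule sg_adj) (simp add: adj_def)
    consider "d < j" | "d = j" | "d = Suc j" | "d = Suc (Suc j)" | "Suc (Suc j) < d" by linarith
    then show ?thesis
    proof cases
      case 1
      then obtain j' where "j = Suc j'" by (cases j) auto
      then show ?thesis using True 1 br by (auto simp flip: mult.assoc)
    qed (use True br in \<open>auto simp flip: mult.assoc\<close>)
  next
    case False
    then have jk: "Suc j < k" using that by simp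
    then obtain k' where k: "k = Suc k'" by (cases k) auto
    consider "d < j" | "d = j" | "d = Suc j" | "Suc j < d" "d < k" | "d = k" | "d = Suc k" | "Suc k < d"
      by linarith
    then show ?thesis
    proof cases
      case 1
      then obtain j' where "j = Suc j'" by (cases j) auto
      then show ?thesis using k jk 1 by (auto simp: sg_sort simp flip: mult.assoc)
    qed (use k jk in \<open>auto simp: sg_sort simp flip: mult.assoc\<close>)
  qed
  have as: "delete d (cpl (Let i) (Sig k) @ Let i # v) = delete d (cpl (Sig k) (Let i) @ Sig k # v)"
    for i k
  proof -
    consider "i < k" | "i = k" | "i = Suc k" | "Suc k < i" by linarith
    then show ?thesis
    proof cases
      case 1
      then obtain k' where k: "k = Suc k'" by (cases k) auto
      consider "d < i" | "d = i" | "d = Suc i" | "Suc i < d" "d < Suc k" | "d = Suc k" | "d = Suc (Suc k)"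
        | "Suc (Suc k) < d"
        by linarith
      then show ?thesis
        by cases (use 1 k in \<open>auto simp: cable_def switch_def al_sg_cases cls_Cons[of _ v] simp flip: mult.assoc\<close>)
    next
      case 2
      consider "d < k" | "d = k" | "d = Suc k" | "d = Suc (Suc k)" | "Suc (Suc k) < d" by linarith
      then show ?thesis
      proof cases
        case 1
        then obtain k' where "k = Suc k'" by (cases k) auto
        then show ?thesis
          using 1 2 al_sg_cases(2)[of k'] by (auto simp: cable_def switch_def simp flip: mult.assoc)
      qed (use 2 in \<open>auto simp: cable_def switch_def al_sg_cases cls_Cons[of _ v] simp flip: mult.assoc\<close>)
    next
      case 3
      consider "d < k" | "d = k" | "d = Suc k" | "d = Suc (Suc k)" | "Suc (Suc k) < d" by linarith
      then show ?thesis
      proof cases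
        case 1
        then obtain k' where "k = Suc k'" by (cases k) auto
        then show ?thesis
          using 1 3 al_sg_cases(3)[of k'] by (auto simp: cable_def switch_def simp flip: mult.assoc)
      qed (use 3 in \<open>auto simp: cable_def switch_def al_sg_cases cls_Cons[of _ v] simp flip: mult.assoc\<close>)
    next
      case 4
      then obtain i' where i: "i = Suc i'" by (cases i) auto
      consider "d < k" | "d = k" | "d = Suc k" | "Suc k < d" "d < i" | "d = i" | "d = Suc i"
        | "Suc i < d"
        by linarith
      then show ?thesis
      proof cases
        case 1
        then obtain k' where "k = Suc k'" by (cases k) auto
        then show ?thesis
          using 1 4 i by (auto simp: cable_def switch_def al_sg_cases simp flip: mult.assoc)
      qed (use 4 i in \<open>auto simp: cable_def switch_def al_sg_cases cls_Cons[of _ v] simp flip: mult.assoc\<close>)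
    qed
  qed
  have aa: "delete d (cpl (Let i) (Let j) @ Let i # v) = delete d (cpl (Let j) (Let i) @ Let j # v)"
    if ij: "i < j" for i j
  proof -
    obtain j' where j: "j = Suc j'" using ij by (cases j) auto
    consider "d < i" | "d = i" | "d = Suc i" | "Suc i < d" "d < Suc j" | "d = Suc j" | "d = Suc (Suc j)"
      | "Suc (Suc j) < d"
      by linarith
    then show ?thesis
    proof cases
      case 1
      then obtain i' where "i = Suc i'" by (cases i) auto
      then show ?thesis using ij 1 j by (auto simp: bump_def al_al_less simp flip: mult.assoc)
    qed (use ij j in \<open>auto simp: bump_def al_al_less cls_Cons[of _ v] simp flip: mult.assoc\<close>)
  qed
  show ?thesis
  proof (cases s; cases t)
    fix j k assume st: "s = Sig j" "t = Sig k"
    consider "j < k" | "j = k" | "k < j" by linarith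
    then show ?thesis unfolding st by cases (rule ss, assumption, simp, rule ss[symmetric])
  next
    fix i j assume st: "s = Let i" "t = Let j"
    consider "i < j" | "i = j" | "j < i" by linarith
    then show ?thesis unfolding st by cases (rule aa, assumption, simp, rule aa[symmetric])
  qed (simp_all only: as)
qed

lemma delete_cong: "cong u v \<Longrightarrow> delete j u = delete j v"
proof (induction arbitrary: j rule: cong_induct)
  case (step u s t v)
  have eq: "cls (cpl s t @ s # v) = cls (cpl t s @ t # v)"
    using cpl_rel[of s t] by (metis cls_append cls_Cons mult.assoc)
  show ?case
    by (induction j u rule: delete.induct) (use eq in \<open>simp_all add: delete_rel[of _ s t]\<close>)
qed auto

text \<open>Deleting strand \<open>i\<close> from a word that begins with \<open>Let i\<close> stops
  at once and leaves the rest of the word.\<close>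

lemma left_cancel_al: "al i * x = al i * y \<Longrightarrow> x = y"
proof -
  assume eq: "al i * x = al i * y"
  obtain u v where uv: "x = cls u" "y = cls v" by (meson cls_surj)
  have "cong (Let i # u) (Let i # v)"
    using eq unfolding uv by (simp flip: cls_eq cls_append)
  then have "delete i (Let i # u) = delete i (Let i # v)" by (rule delete_cong)
  then show "x = y" by (simp add: uv)
qed

section \<open>Factorization into a braid and an element of Thompson's monoid\<close>

abbreviation als :: "nat list \<Rightarrow> bmon"
  where "als f \<equiv> cls (map Let f)"

lemma als_Cons: "als (i # f) = al i * als f"
  using cls_Cons[of "Let i" "map Let f"] by simp

text \<open>The index set bounds the crossings that may occur, so that braids on finitely many
  strands can be treated with one Garside element.\<close>

definition braids :: "nat set \<Rightarrow> bmon set"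
  where "braids K = {sgs u | u. set u \<subseteq> K}"

lemma braids_one [simp]: "1 \<in> braids K"
  unfolding braids_def by (auto intro: exI[of _ "[]"])

lemma braids_sg [simp]: "sg k \<in> braids K" if "k \<in> K"
  unfolding braids_def using that by (auto intro!: exI[of _ "[k]"])

lemma braids_mult: "x \<in> braids K \<Longrightarrow> y \<in> braids K \<Longrightarrow> x * y \<in> braids K"
  unfolding braids_def
proof clarsimp
  fix u v assume "set u \<subseteq> K" "set v \<subseteq> K"
  then show "\<exists>w. sgs u * sgs v = sgs w \<and> set w \<subseteq> K"
    by (intro exI[of _ "u @ v"]) auto
qed

lemma braids_mono: "K \<subseteq> L \<Longrightarrow> braids K \<subseteq> braids L"
  unfolding braids_def by auto

lemma braids_sgs: "sgs u \<in> braids UNIV"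
  unfolding braids_def by auto

lemma braids_cab: "cab i k \<in> braids UNIV"
  unfolding sgs_cable_ind[symmetric] by (rule braids_sgs)

lemma braids_cabs: "cabs x u \<in> braids UNIV"
  by (induction u) (auto intro: braids_mult braids_cab)

lemma switch_switch [simp]: "switch k (switch k i) = i"
  by (auto simp: switch_def)

lemma switchs_surj: "\<exists>x. switchs u x = i"
proof (induction u arbitrary: i)
  case (Cons k u)
  then obtain x where "switchs u x = switch k i" by blast
  then show ?case by (auto intro: exI[of _ x])
qed simp

lemma al_braid:
  assumes "b \<in> braids UNIV"
  shows "\<exists>c \<in> braids UNIV. \<exists>j. al i * b = c * al j"
proof -
  obtain u where u: "b = sgs u" using assms unfolding braids_def by blast
  \<comment> \<open>The strand that begins at \<open>i\<close> ends at some \<open>x\<close>; this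
    is the strand to double.\<close>
  obtain x where "switchs u x = i" using switchs_surj by blast
  then show ?thesis using al_sgs[of u x] braids_cabs u by metis
qed

lemma als_braid:
  "b \<in> braids UNIV \<Longrightarrow> \<exists>c \<in> braids UNIV. \<exists>g. als f * b = c * als g"
proof (induction f)
  case Nil
  then show ?case by (auto intro!: bexI[of _ b] exI[of _ "[]"])
next
  case (Cons i f)
  obtain c g where c: "c \<in> braids UNIV" "als f * b = c * als g"
    using Cons by blast
  obtain d j where d: "d \<in> braids UNIV" "al i * c = d * al j"
    using al_braid[OF c(1)] by blast
  have "als (i # f) * b = al i * (als f * b)"
    by (simp only: als_Cons mult.assoc)
  also have "\<dots> = d * als (j # g)"
    unfolding c(2) als_Cons using d(2) by (metis mult.assoc)
  finally show ?case using d(1) by blast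
qed

lemma braid_als_decomposition: "\<exists>b \<in> braids UNIV. \<exists>f. x = b * als f"
proof (induction x rule: bmon_induct)
  case one
  show ?case by (intro bexI[of _ 1] exI[of _ "[]"]) auto
next
  case (snoc x s)
  then obtain b f where b: "b \<in> braids UNIV" "x = b * als f" by blast
  show ?case
  proof (cases s)
    case (Sig k)
    obtain c g where c: "c \<in> braids UNIV" "als f * sg k = c * als g"
      using als_braid[OF braids_sg] by blast
    have "x * gen s = (b * c) * als g"
      unfolding b(2) Sig using c(2) by (simp add: mult.assoc)
    then show ?thesis using braids_mult[OF b(1) c(1)] by blast
  next
    case (Let i)
    have "x * gen s = b * als (f @ [i])" using b(2) Let by (simp add: mult.assoc)
    then show ?thesis using b(1) by blast
  qed
qed

text \<open>The number of joining letters is preserved by every relation, although the length of a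
  word is not.\<close>

fun lets :: "letter list \<Rightarrow> nat"
  where
    "lets [] = 0"
  | "lets (Sig k # v) = lets v"
  | "lets (Let i # v) = Suc (lets v)"

lemma lets_append: "lets (u @ v) = lets u + lets v"
  by (induction u rule: lets.induct) auto

lemma lets_cong: "cong u v \<Longrightarrow> lets u = lets v"
proof (induction rule: cong_induct)
  case (step u s t v)
  show ?case by (cases s; cases t) (auto simp: lets_append cable_def)
qed auto

lemma lets_map [simp]: "lets (map Sig u) = 0" "lets (map Let f) = length f"
  by (induction u, simp_all) (induction f, simp_all)

text \<open>Induction on the length of \<open>f\<close>, comparing last letters. If they differ,
  \<open>gen_lcm\<close> gives a common left part \<open>q\<close>; the factorization of
  \<open>q\<close>, extended by one letter, agrees with that of either side by the induction
  hypothesis, so both sides have the same braid.\<close>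

lemma braid_als_unique:
  assumes "b \<in> braids UNIV" "c \<in> braids UNIV" "b * als f = c * als g"
  shows "b = c \<and> als f = als g"
  using assms
proof (induction "length f" arbitrary: b c f g)
  case (0 f b c g)
  obtain u v where uv: "b = sgs u" "c = sgs v" using 0 unfolding braids_def by blast
  have "cls (map Sig u @ map Let f) = cls (map Sig v @ map Let g)" using 0(4) uv by simp
  then have "length f = length g" using lets_cong[of "_ @ _" "_ @ _"]
    unfolding cls_eq by (fastforce simp: lets_append)
  then show ?case using 0 by simp
next
  case (Suc n f b c g)
  obtain u v where uv: "b = sgs u" "c = sgs v" using Suc.prems unfolding braids_def by blast
  have "cls (map Sig u @ map Let f) = cls (map Sig v @ map Let g)" using Suc.prems(3) uv by simp
  then have len: "length f = length g" using lets_cong[of "_ @ _" "_ @ _"]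
    unfolding cls_eq by (fastforce simp: lets_append)
  obtain f' i where f: "f = f' @ [i]" using Suc.hyps(2) by (metis length_Suc_conv rev_exhaust list.distinct(1))
  obtain g' j where g: "g = g' @ [j]" using Suc.hyps(2) len
    by (metis length_Suc_conv rev_exhaust list.distinct(1))
  have n: "n = length f'" "n = length g'" using f g len Suc.hyps(2) by auto
  have eq: "b * als f' * al i = c * als g' * al j"
    using Suc.prems(3) f g by (simp add: mult.assoc)
  show ?case
  proof (cases "i = j")
    case True
    then have "b * als f' = c * als g'" using eq right_cancel_gen by blast
    then show ?thesis using Suc.hyps(1)[OF n(1) Suc.prems(1,2)] f g True by simp
  next
    case False
    then obtain q where q: "b * als f' = q * al (bump i j)" "c * als g' = q * al (bump j i)"
      using gen_lcm[OF eq] by auto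
    obtain d h where d: "d \<in> braids UNIV" "q = d * als h"
      using braid_als_decomposition by blast
    have "b * als f' = d * als (h @ [bump i j])" "c * als g' = d * als (h @ [bump j i])"
      using q d by (simp_all add: mult.assoc)
    then have "b = d \<and> als f' = als (h @ [bump i j])" "c = d \<and> als g' = als (h @ [bump j i])"
      using Suc.hyps(1)[OF n(1) Suc.prems(1) d(1)] Suc.hyps(1)[OF n(2) Suc.prems(2) d(1)] by blast+
    then show ?thesis
      unfolding f g using al_al'[OF False, of "als h"] by simp
  qed
qed

text \<open>The relations between crossings are invariant under reversal. Every other relation has a
  letter \<open>Let\<close> on both sides, so a derivation from a braid word stays within braid
  words; this equivalence is carried along for transitivity.\<close>

lemma cong_rev:
  "cong u v \<Longrightarrow> (set u \<subseteq> range Sig \<longleftrightarrow> set v \<subseteq> range Sig) \<and>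
    (set u \<subseteq> range Sig \<longrightarrow> cong (rev u) (rev v))"
proof (induction rule: cong_induct)
  case (refl u)
  then show ?case by (simp add: presented_cong.refl)
next
  case (step u s t v)
  have ss: "cls (Sig j # rev (cpl (Sig j) (Sig k))) = cls (Sig k # rev (cpl (Sig k) (Sig j)))" for j k
    by (cases j k rule: cases_adj_far)
      (simp_all add: cpl_sig adj_sym far_sym sg_far sg_adj del: cpl.simps flip: mult.assoc)
  show ?case
  proof (cases s; cases t)
    fix j k assume st: "s = Sig j" "t = Sig k"
    have "cls (rev v @ (Sig j # rev (cpl (Sig j) (Sig k))) @ rev u)
      = cls (rev v @ (Sig k # rev (cpl (Sig k) (Sig j))) @ rev u)"
      unfolding cls_append ss[of j k] ..
    then show ?thesis unfolding cls_eq st by auto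
  qed (auto simp: cable_def)
next
  case (sym u v)
  then show ?case by (blast intro: presented_cong.sym)
next
  case (trans u v w)
  then show ?case by (blast intro: presented_cong.trans)
qed

text \<open>Reversal turns right cancellation into left cancellation.\<close>

lemma left_cancel_sg_braid:
  assumes "b \<in> braids UNIV" "c \<in> braids UNIV" "sg k * b = sg k * c"
  shows "b = c"
proof -
  obtain u v where uv: "b = sgs u" "c = sgs v" using assms unfolding braids_def by blast
  have rev: "sgs (rev u) = sgs (rev v)" if "sgs u = sgs v" for u v
    using cong_rev[of "map Sig u" "map Sig v"] that by (auto simp: cls_eq rev_map)
  have "sgs (k # u) = sgs (k # v)" using assms(3) uv by (simp only: sgs_Cons)
  from rev[OF this] have "sgs (rev u) * sg k = sgs (rev v) * sg k" by simp
  then have "sgs (rev u) = sgs (rev v)" by (rule right_cancel_gen)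
  from rev[OF this] show ?thesis using uv by simp
qed

lemma left_cancel_gen: "gen s * x = gen s * y \<Longrightarrow> x = y"
proof (cases s)
  case (Sig k)
  assume eq: "gen s * x = gen s * y"
  obtain b f where b: "b \<in> braids UNIV" "x = b * als f" using braid_als_decomposition by blast
  obtain c g where c: "c \<in> braids UNIV" "y = c * als g" using braid_als_decomposition by blast
  have "(sg k * b) * als f = (sg k * c) * als g" using eq Sig b c by (simp add: mult.assoc)
  then have "sg k * b = sg k * c" "als f = als g"
    using braid_als_unique braids_mult[OF braids_sg] b(1) c(1) by blast+
  then show ?thesis using left_cancel_sg_braid b c by metis
next
  case (Let i)
  then show "gen s * x = gen s * y \<Longrightarrow> x = y" using left_cancel_al by simp
qed

lemma left_cancel: "z * x = z * y \<Longrightarrow> x = (y :: bmon)"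
proof (induction z arbitrary: x y rule: bmon_induct)
  case (snoc z s)
  then show ?case using left_cancel_gen by (metis mult.assoc)
qed simp

section \<open>Common left multiples\<close>

fun ladder :: "nat \<Rightarrow> bmon"
  where
    "ladder 0 = sg 0"
  | "ladder (Suc n) = sg (Suc n) * ladder n"

text \<open>Garside's half twist on \<open>n + 1\<close> strands, made of the crossings
  \<open>sg k\<close> with \<open>k < n\<close>.\<close>

fun Delta :: "nat \<Rightarrow> bmon"
  where
    "Delta 0 = 1"
  | "Delta (Suc n) = Delta n * ladder n"

lemma ladder_comm: "Suc n < k \<Longrightarrow> ladder n * sg k = sg k * ladder n"
proof (induction n)
  case (Suc n)
  then show ?case using sg_sort(1)[of "Suc n" k] by (metis Suc_lessD ladder.simps(2) mult.assoc)
qed (simp add: sg_sort)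

lemma Delta_comm: "n < k \<Longrightarrow> Delta n * sg k = sg k * Delta n"
proof (induction n)
  case (Suc n)
  then show ?case using ladder_comm[of n k] by (metis Suc_lessD Delta.simps(2) mult.assoc)
qed simp

text \<open>The descending product from \<open>sg n\<close> to \<open>sg 0\<close> carries one
  strand across all the others, so crossings among the others shift by one position.\<close>

lemma ladder_shift: "k < n \<Longrightarrow> ladder n * sg (Suc k) = sg k * ladder n"
proof (induction n)
  case (Suc n)
  show ?case
  proof (cases "k = n")
    case False
    then have "k < n" using Suc.prems by simp
    then have "ladder (Suc n) * sg (Suc k) = sg (Suc n) * sg k * ladder n"
      using Suc.IH by (simp add: mult.assoc)
    also have "\<dots> = sg k * sg (Suc n) * ladder n"
      using \<open>k < n\<close> by (simp add: sg_sort)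
    finally show ?thesis by (simp add: mult.assoc)
  next
    case True
    have br: "sg (Suc n) * sg n * sg (Suc n) = sg n * sg (Suc n) * sg n"
      by (rule sg_adj) (simp add: adj_def)
    show ?thesis
    proof (cases n)
      case 0
      then show ?thesis using br True by (simp add: mult.assoc)
    next
      case (Suc m)
      have "ladder (Suc n) * sg (Suc n) = sg (Suc n) * sg n * (ladder m * sg (Suc n))"
        using Suc by (simp add: mult.assoc)
      also have "\<dots> = sg (Suc n) * sg n * sg (Suc n) * ladder m"
        using Suc ladder_comm[of m "Suc n"] by (simp add: mult.assoc)
      also have "\<dots> = sg n * ladder (Suc n)"
        unfolding br using Suc by (simp add: mult.assoc)
      finally show ?thesis using True by simp
    qed
  qed
qed simp

text \<open>For \<open>m = n\<close> it absorbs a final \<open>sg 0\<close>, the crossing that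
  \<open>ladder_shift\<close> does not cover.\<close>

lemma ladder_ladder:
  "m \<le> n \<Longrightarrow> ladder (Suc n) * ladder (Suc m) = ladder m * ladder (Suc n) * sg 0"
proof (induction m)
  case 0
  then show ?case using ladder_shift[of 0 "Suc n"] by (simp flip: mult.assoc)
next
  case (Suc m)
  have "ladder (Suc n) * ladder (Suc (Suc m)) = (ladder (Suc n) * sg (Suc (Suc m))) * ladder (Suc m)"
    by (simp add: mult.assoc)
  also have "\<dots> = sg (Suc m) * (ladder (Suc n) * ladder (Suc m))"
    using ladder_shift[of "Suc m" "Suc n"] Suc.prems by (simp add: mult.assoc del: ladder.simps)
  also have "\<dots> = ladder (Suc m) * ladder (Suc n) * sg 0"
    using Suc by (simp add: mult.assoc)
  finally show ?case .
qed

text \<open>Conjugation by the half twist turns \<open>k\<close> into \<open>n - 1 - k\<close>; the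
  statement keeps only the bound, which makes \<open>braids {..<n}\<close> stable under it.\<close>

lemma Delta_sg: "k < n \<Longrightarrow> \<exists>l < n. Delta n * sg k = sg l * Delta n"
proof (induction n arbitrary: k)
  case (Suc n)
  show ?case
  proof (cases k)
    case (Suc j)
    then have j: "j < n" using Suc.prems by simp
    then obtain l where l: "l < n" "Delta n * sg j = sg l * Delta n" using Suc.IH by blast
    have "Delta (Suc n) * sg k = Delta n * sg j * ladder n"
      using ladder_shift[OF j] Suc by (simp add: mult.assoc)
    also have "\<dots> = sg l * Delta (Suc n)" using l(2) by (simp add: mult.assoc)
    finally show ?thesis using l(1) less_SucI by blast
  next
    case 0
    show ?thesis
    proof (cases n)
      case 0
      then show ?thesis using \<open>k = 0\<close> by auto
    next
      case (Suc m)
      have "Delta (Suc n) * sg k = Delta m * (ladder m * ladder (Suc m) * sg 0)"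
        using Suc \<open>k = 0\<close> by (simp add: mult.assoc)
      also have "\<dots> = Delta m * sg (Suc m) * ladder m * ladder (Suc m)"
        unfolding ladder_ladder[OF order.refl, symmetric] by (simp add: mult.assoc)
      also have "\<dots> = sg n * Delta (Suc n)"
        using Delta_comm[of m "Suc m"] Suc by (simp add: mult.assoc)
      finally show ?thesis by blast
    qed
  qed
qed simp

lemma ladder_braids: "ladder n \<in> braids {..n}"
proof (induction n)
  case (Suc n)
  then have "ladder n \<in> braids {..Suc n}" using braids_mono[of "{..n}" "{..Suc n}"] by auto
  then show ?case by (simp add: braids_mult)
qed simp

lemma Delta_braids: "Delta n \<in> braids {..<n}"
proof (induction n)
  case (Suc n)
  then have "Delta n \<in> braids {..<Suc n}"
    using braids_mono[of "{..<n}" "{..<Suc n}"] by auto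
  then show ?case using ladder_braids[of n] by (simp add: braids_mult lessThan_Suc_atMost)
qed simp

lemma ladder_end: "\<exists>e \<in> braids {..n}. ladder n = e * sg 0"
proof (induction n)
  case 0
  show ?case by (intro bexI[of _ 1]) simp_all
next
  case (Suc n)
  then obtain e where "e \<in> braids {..n}" "ladder n = e * sg 0" by blast
  then show ?case using braids_mono[of "{..n}" "{..Suc n}"]
    by (intro bexI[of _ "sg (Suc n) * e"]) (auto intro!: braids_mult simp: mult.assoc)
qed

lemma Delta_end: "k < n \<Longrightarrow> \<exists>e \<in> braids {..<n}. Delta n = e * sg k"
proof (induction n arbitrary: k)
  case (Suc n)
  have sub: "braids {..<n} \<subseteq> braids {..<Suc n}" by (rule braids_mono) auto
  show ?case
  proof (cases k)
    case 0
    obtain e where "e \<in> braids {..<Suc n}" "ladder n = e * sg 0"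
      using ladder_end[of n] unfolding lessThan_Suc_atMost by blast
    then show ?thesis using 0 sub Delta_braids[of n]
      by (intro bexI[of _ "Delta n * e"]) (auto intro!: braids_mult simp: mult.assoc)
  next
    case (Suc j)
    then have j: "j < n" using Suc.prems by simp
    then obtain e where e: "e \<in> braids {..<n}" "Delta n = e * sg j" using Suc.IH by blast
    have "Delta (Suc n) = e * ladder n * sg k"
      using e(2) ladder_shift[OF j] Suc by (simp add: mult.assoc)
    moreover have "e * ladder n \<in> braids {..<Suc n}"
      using e(1) sub ladder_braids[of n] by (intro braids_mult) (auto simp: lessThan_Suc_atMost)
    ultimately show ?thesis by blast
  qed
qed simp

lemma Delta_braid_comm:
  assumes "b \<in> braids {..<n}"
  shows "\<exists>c \<in> braids {..<n}. Delta n * b = c * Delta n"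
proof -
  have "\<exists>c \<in> braids {..<n}. Delta n * sgs u = c * Delta n" if "set u \<subseteq> {..<n}" for u
    using that
  proof (induction u)
    case Nil
    show ?case by (intro bexI[of _ 1]) simp_all
  next
    case (Cons k u)
    then obtain c where c: "c \<in> braids {..<n}" "Delta n * sgs u = c * Delta n" by auto
    obtain l where l: "l < n" "Delta n * sg k = sg l * Delta n" using Delta_sg[of k n] Cons.prems by auto
    have "Delta n * sgs (k # u) = (sg l * c) * Delta n"
      using l(2) c(2) by (metis sgs_Cons mult.assoc)
    then show ?case using l(1) c(1) by (intro bexI[of _ "sg l * c"]) (auto intro: braids_mult)
  qed
  then show ?thesis using assms unfolding braids_def by blast
qed

lemma Delta_power_comm:
  "b \<in> braids {..<n} \<Longrightarrow> \<exists>c \<in> braids {..<n}. Delta n ^ m * b = c * Delta n ^ m"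
proof (induction m arbitrary: b)
  case 0
  then show ?case by auto
next
  case (Suc m)
  obtain c where c: "c \<in> braids {..<n}" "Delta n ^ m * b = c * Delta n ^ m" using Suc by blast
  obtain d where d: "d \<in> braids {..<n}" "Delta n * c = d * Delta n"
    using Delta_braid_comm[OF c(1)] by blast
  have "Delta n ^ Suc m * b = d * Delta n ^ Suc m"
    using c(2) d(2) by (metis power_Suc mult.assoc)
  then show ?case using d(1) by blast
qed

text \<open>Each factor \<open>Delta n\<close> supplies one crossing as a right factor; its cofactor
  \<open>e\<close> is moved to the left across the earlier power.\<close>

lemma Delta_power_multiple:
  "set u \<subseteq> {..<n} \<Longrightarrow> \<exists>c \<in> braids {..<n}. Delta n ^ length u = c * sgs u"
proof (induction u rule: rev_induct)
  case Nil
  show ?case by (intro bexI[of _ 1]) simp_all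
next
  case (snoc k u)
  obtain c where c: "c \<in> braids {..<n}" "Delta n ^ length u = c * sgs u" using snoc by auto
  obtain e where e: "e \<in> braids {..<n}" "Delta n = e * sg k"
    using Delta_end[of k n] snoc.prems by auto
  obtain d where d: "d \<in> braids {..<n}" "Delta n ^ length u * e = d * Delta n ^ length u"
    using Delta_power_comm[OF e(1)] by blast
  have "Delta n ^ length (u @ [k]) = Delta n ^ length u * (e * sg k)"
    using e(2) by (metis length_append_singleton power_Suc2)
  also have "\<dots> = d * (c * sgs u) * sg k"
    using d(2) c(2) by (metis mult.assoc)
  finally have "Delta n ^ length (u @ [k]) = (d * c) * sgs (u @ [k])"
    by (simp add: mult.assoc)
  then show ?case using braids_mult[OF d(1) c(1)] by blast
qed

lemma braid_common_multiple:
  assumes "b \<in> braids UNIV"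
  shows "\<exists>c \<in> braids UNIV. \<exists>d \<in> braids UNIV. c * sg k = d * b"
proof -
  obtain u where u: "b = sgs u" using assms unfolding braids_def by blast
  define n where "n = Suc (Max (set (k # u)))"
  have n: "set u \<subseteq> {..<n}" "k < n"
    unfolding n_def by (auto simp: less_Suc_eq_le intro!: Max_ge)
  obtain d where d: "d \<in> braids {..<n}" "Delta n ^ length u = d * sgs u"
    using Delta_power_multiple[OF n(1)] by blast
  obtain e where e: "e \<in> braids {..<n}" "Delta n = e * sg k" using Delta_end[OF n(2)] by blast
  have power: "Delta n ^ m \<in> braids {..<n}" for m
    by (induction m) (auto intro: braids_mult Delta_braids)
  \<comment> \<open>Both sides equal \<open>Delta n ^ Suc (length u)\<close>.\<close>
  have "(Delta n ^ length u * e) * sg k = (Delta n * d) * b"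
    using d(2) e(2) u by (metis mult.assoc power_commutes)
  moreover have "Delta n ^ length u * e \<in> braids UNIV" "Delta n * d \<in> braids UNIV"
    using braids_mult[OF power e(1)] braids_mult[OF Delta_braids d(1)]
      braids_mono[of "{..<n}" UNIV] by auto
  ultimately show ?thesis by blast
qed

section \<open>Common left multiples in the whole monoid\<close>

lemma common_multiple_braid:
  "b \<in> braids UNIV \<Longrightarrow> \<exists>u v. u * x = v * b"
proof (induction x arbitrary: b rule: bmon_induct)
  case one
  show ?case by (intro exI[of _ b] exI[of _ 1]) simp
next
  case (snoc x s)
  show ?case
  proof (cases s)
    case (Sig k)
    obtain c d where cd: "c \<in> braids UNIV" "d \<in> braids UNIV" "c * sg k = d * b"
      using braid_common_multiple[OF snoc.prems] by blast
    obtain u v where "u * x = v * c" using snoc.IH[OF cd(1)] by blast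
    then have "u * (x * gen s) = (v * d) * b"
      unfolding Sig using cd(3) by (metis mult.assoc)
    then show ?thesis by blast
  next
    case (Let i)
    obtain w where w: "b = sgs w" using snoc.prems unfolding braids_def by blast
    \<comment> \<open>Pushing a join through \<open>b\<close> replaces it by a braid with one strand
      doubled, to which the induction hypothesis applies because \<open>b\<close> is arbitrary
      there.\<close>
    obtain u v where "u * x = v * cabs i w" using snoc.IH[OF braids_cabs] by blast
    then have "u * (x * gen s) = (v * al (switchs w i)) * b"
      unfolding Let w using al_sgs[of w i] by (metis mult.assoc)
    then show ?thesis by blast
  qed
qed

lemma common_multiple_al: "\<exists>u v. u * x = v * al i"
proof (induction x arbitrary: i rule: bmon_induct)
  case one
  show ?case by (intro exI[of _ "al i"] exI[of _ 1]) simp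
next
  case (snoc x s)
  show ?case
  proof (cases "s = Let i")
    case True
    then show ?thesis by (metis mult_1)
  next
    case False
    \<comment> \<open>On the side of \<open>s\<close> the complement is always one joining letter,
      so the induction can continue with \<open>al j\<close>.\<close>
    obtain j where "cpl s (Let i) = [Let j]" using False by (cases s) auto
    then have "al j * gen s = cls (cpl (Let i) s) * al i" using cpl_rel[of s "Let i"] by simp
    moreover obtain u v where "u * x = v * al j" using snoc by blast
    ultimately have "u * (x * gen s) = (v * cls (cpl (Let i) s)) * al i" by (metis mult.assoc)
    then show ?thesis by blast
  qed
qed

lemma common_multiple: "\<exists>u v. u * x = v * (y :: bmon)"
proof (induction y arbitrary: x rule: bmon_induct)
  case one
  show ?case by (intro exI[of _ 1] exI[of _ x]) simp
next
  case (snoc y s)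
  obtain u v where uv: "u * x = v * gen s"
    using common_multiple_al common_multiple_braid[OF braids_sg] by (cases s) blast+
  obtain u' v' where "u' * v = v' * y" using snoc by blast
  then have "(u' * u) * x = v' * (y * gen s)" using uv by (metis mult.assoc)
  then show ?case by blast
qed

lemma lcm_exists: "\<exists>m. \<forall>h. rdiv x h \<and> rdiv y h \<longleftrightarrow> rdiv m h"
proof -
  obtain u v where "u * x = v * y" using common_multiple by blast
  then show ?thesis using lcm_conditional[of x "v * y" y] by (metis rdiv_mult)
qed

lemma finite_lcm:
  "finite A \<Longrightarrow> \<exists>m. \<forall>h. (\<forall>x \<in> A. rdiv x h) \<longleftrightarrow> rdiv m h"
proof (induction rule: finite_induct)
  case empty
  show ?case by (auto intro: exI[of _ 1])
next
  case (insert x A)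
  then obtain m where "\<And>h. (\<forall>x \<in> A. rdiv x h) \<longleftrightarrow> rdiv m h" by blast
  then show ?case using lcm_exists[of x m] by auto
qed

text \<open>A left factor of 1 has weight 0 and hence is 1.\<close>

lemma power_eq_1_imp: "x ^ n = 1 \<Longrightarrow> n > 0 \<Longrightarrow> x = (1 :: bmon)"
proof -
  assume "x ^ n = 1" "n > 0"
  then obtain m where "x * x ^ m = 1" by (metis gr0_conv_Suc power_Suc)
  moreover have "weight 1 = 0" using weight_cls[of "[]"] by simp
  ultimately have "weight x = 0" using weight_mult_ge[of x "x ^ m"] by simp
  then show "x = 1" by (rule weight_eq_0)
qed

section \<open>The group of left fractions\<close>

fun raise :: "letter \<Rightarrow> letter"
  where "raise (Sig i) = Sig (Suc i)" | "raise (Let i) = Let (Suc i)"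

fun lower :: "letter \<Rightarrow> letter"
  where "lower (Sig i) = Sig (i - 1)" | "lower (Let i) = Let (i - 1)"

lemma lower_raise [simp]: "lower (raise s) = s"
  by (cases s) auto

lemma raise_lower [simp]: "s \<in> gens \<Longrightarrow> raise (lower s) = s"
  by (auto simp: gens_def)

lemma raise_gens [simp]: "raise s \<in> gens"
  by (cases s) (auto simp: gens_def)

lemma map_lower_raise [simp]: "map lower (map raise u) = u"
  by (induction u) auto

lemma map_raise_lower: "w \<in> lists gens \<Longrightarrow> map raise (map lower w) = w"
  by (induction w) auto

lemma map_raise_lists: "map raise u \<in> lists gens"
  by auto

abbreviation mcong :: "(letter list \<times> letter list) set"
  where "mcong \<equiv> presented_cong gens R_bullet"

lemma mcong_R_bullet:
  assumes "(map raise l, map raise r) \<in> R_bullet"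
  shows "(map raise l, map raise r) \<in> mcong" "(map raise r, map raise l) \<in> mcong"
  using presented_cong.step[OF assms, of "[]" "[]" gens] map_raise_lists
  by (simp_all add: presented_cong.sym)

lemma raise_rel: "(map raise (cpl s t @ [s]), map raise (cpl t s @ [t])) \<in> mcong"
proof -
  have refl: "(map raise u, map raise u) \<in> mcong" for u
    by (rule presented_cong.refl) auto
  have ss: "(map raise (cpl (Sig j) (Sig k) @ [Sig j]), map raise (cpl (Sig k) (Sig j) @ [Sig k])) \<in> mcong
      \<and> (map raise (cpl (Sig k) (Sig j) @ [Sig k]), map raise (cpl (Sig j) (Sig k) @ [Sig j])) \<in> mcong"
    if "j < k" for j k
  proof (cases "k = Suc j")
    case True
    then show ?thesis
      using mcong_R_bullet[of "[Sig j, Sig k, Sig j]" "[Sig k, Sig j, Sig k]"]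
        R_bullet.intros(5)[of "Suc j"] by simp
  next
    case False
    then show ?thesis
      using that mcong_R_bullet[of "[Sig j, Sig k]" "[Sig k, Sig j]"]
        R_bullet.intros(1)[of "Suc j" "Suc k"] by simp
  qed
  have as: "(map raise (cpl (Let i) (Sig k) @ [Let i]), map raise (cpl (Sig k) (Let i) @ [Sig k])) \<in> mcong
      \<and> (map raise (cpl (Sig k) (Let i) @ [Sig k]), map raise (cpl (Let i) (Sig k) @ [Let i])) \<in> mcong"
    for i k
  proof -
    consider "i < k" | "i = k" | "i = Suc k" | "Suc k < i" by linarith
    then show ?thesis
    proof cases
      case 1
      then show ?thesis
        using mcong_R_bullet[of "[Let i, Sig k]" "[Sig (Suc k), Let i]"]
          R_bullet.intros(4)[of "Suc i" "Suc (Suc k)"] by (simp add: cable_def switch_def)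
    next
      case 2
      then show ?thesis
        using mcong_R_bullet[of "[Sig k, Sig (Suc k), Let k]" "[Let (Suc k), Sig k]"]
          R_bullet.intros(7)[of "Suc k"] by (simp add: cable_def switch_def)
    next
      case 3
      then show ?thesis
        using mcong_R_bullet[of "[Sig (Suc k), Sig k, Let (Suc k)]" "[Let k, Sig k]"]
          R_bullet.intros(6)[of "Suc k"] by (simp add: cable_def switch_def)
    next
      case 4
      then show ?thesis
        using mcong_R_bullet[of "[Sig k, Let i]" "[Let i, Sig k]"]
          R_bullet.intros(2)[of "Suc k" "Suc i"] by (simp add: cable_def switch_def)
    qed
  qed
  have aa: "(map raise (cpl (Let i) (Let j) @ [Let i]), map raise (cpl (Let j) (Let i) @ [Let j])) \<in> mcong
      \<and> (map raise (cpl (Let j) (Let i) @ [Let j]), map raise (cpl (Let i) (Let j) @ [Let i])) \<in> mcong"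
    if "i < j" for i j
    using that mcong_R_bullet[of "[Let i, Let j]" "[Let (Suc j), Let i]"]
      R_bullet.intros(3)[of "Suc i" "Suc (Suc j)"] by (simp add: bump_def)
  show ?thesis
  proof (cases s; cases t)
    fix j k assume st: "s = Sig j" "t = Sig k"
    show ?thesis unfolding st using ss[of j k] ss[of k j] refl by (cases j k rule: linorder_cases) blast+
  next
    fix i j assume st: "s = Let i" "t = Let j"
    show ?thesis unfolding st using aa[of i j] aa[of j i] refl by (cases i j rule: linorder_cases) blast+
  qed (simp_all only: as)
qed

lemma raise_cong: "cong u v \<Longrightarrow> (map raise u, map raise v) \<in> mcong"
proof (induction rule: cong_induct)
  case (refl u)
  show ?case by (rule presented_cong.refl) auto
next
  case (step u s t v)
  show ?case
    using presented_cong_context[OF raise_rel[of s t] map_raise_lists[of u] map_raise_lists[of v]]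
    by simp
qed (blast intro: presented_cong.sym presented_cong.trans)+

text \<open>The counterpart of \<open>raise_cong\<close>; it shows that the two sides of a positive
  relation act alike in \<open>acts_gcong\<close>.\<close>

lemma lower_R_bullet: "(l, r) \<in> R_bullet \<Longrightarrow> cls (map lower l) = cls (map lower r)"
proof (induction rule: R_bullet.induct)
  case (1 i j)
  then show ?case by (simp add: sg_sort)
next
  case (2 i j)
  then show ?case using al_sg_cases(4)[of "i - 1" "j - 1"] by simp
next
  case (3 i j)
  then have "j = Suc (Suc (j - 2))" by simp
  then obtain j' where "j = Suc (Suc j')" ..
  then show ?case using 3 al_al_less[of "i - 1" j'] by simp
next
  case (4 i j)
  then have "j = Suc (Suc (j - 2))" by simp
  then obtain j' where "j = Suc (Suc j')" ..
  then show ?case using 4 al_sg_cases(1)[of "i - 1" j'] by simp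
next
  case (5 i)
  then show ?case using sg_adj[of "i - 1" i] by (simp add: adj_def mult.assoc)
next
  case (6 i)
  then show ?case using al_sg_cases(3)[of "i - 1"] by (simp add: mult.assoc)
next
  case (7 i)
  then show ?case using al_sg_cases(2)[of "i - 1"] by (simp add: mult.assoc)
qed

lift_definition to_monoid :: "bmon \<Rightarrow> letter list set" is "\<lambda>u. mcong `` {map raise u}"
  by (rule presented_cong_class_eq[OF raise_cong])

lemma to_monoid_cls: "to_monoid (cls u) = mcong `` {map raise u}"
  by transfer simp

lemma to_monoid_closed: "to_monoid x \<in> carrier B_monoid"
proof -
  obtain u where "x = cls u" by (rule cls_surj)
  then show ?thesis
    unfolding B_monoid_def by (simp only: to_monoid_cls presented_monoid_closed[OF map_raise_lists])
qed

lemma to_monoid_surj: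
  assumes "C \<in> carrier B_monoid"
  obtains x where "C = to_monoid x"
proof -
  obtain w where "w \<in> lists gens" "C = mcong `` {w}"
    using assms unfolding B_monoid_def by (rule presented_monoid_cases)
  then have "C = to_monoid (cls (map lower w))"
    by (simp only: to_monoid_cls map_raise_lower)
  then show ?thesis by (rule that)
qed

lemma to_monoid_mult: "to_monoid (x * y) = to_monoid x \<otimes>\<^bsub>B_monoid\<^esub> to_monoid y"
proof -
  obtain u v where "x = cls u" "y = cls v" by (meson cls_surj)
  then show ?thesis
    unfolding B_monoid_def
    by (simp only: to_monoid_cls presented_monoid_mult[OF map_raise_lists map_raise_lists]
        map_append flip: cls_append)
qed

lemma to_monoid_one: "to_monoid 1 = \<one>\<^bsub>B_monoid\<^esub>"
  unfolding B_monoid_def using to_monoid_cls[of "[]"] by simp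

section \<open>The map into the group and the action that makes it injective\<close>

interpretation BG: group B_group
  unfolding B_group_def by (rule group_presented_group)

abbreviation gcong :: "((bool \<times> letter) list \<times> (bool \<times> letter) list) set"
  where "gcong \<equiv> presented_cong (UNIV \<times> gens) (group_relations gens R_bullet)"

definition emb :: "bmon \<Rightarrow> (bool \<times> letter) list set"
  where "emb x = B_canon (to_monoid x)"

lemma emb_cls: "emb (cls u) = gcong `` {pos_word (map raise u)}"
  unfolding emb_def B_canon_def to_monoid_cls by (rule canonical_map_class[OF map_raise_lists])

lemma emb_closed [simp]: "emb x \<in> carrier B_group"
proof -
  obtain u where "x = cls u" by (rule cls_surj)
  then show ?thesis
    unfolding B_group_def presented_group_def
    by (simp only: emb_cls presented_monoid_closed[OF pos_word_lists[OF map_raise_lists]])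
qed

lemma emb_mult: "emb (x * y) = emb x \<otimes>\<^bsub>B_group\<^esub> emb y"
proof -
  obtain u v where "x = cls u" "y = cls v" by (meson cls_surj)
  then show ?thesis
    unfolding B_group_def presented_group_def
    by (simp only: emb_cls presented_monoid_mult[OF pos_word_lists pos_word_lists, OF map_raise_lists map_raise_lists]
        map_append flip: cls_append)
qed

lemma emb_one [simp]: "emb 1 = \<one>\<^bsub>B_group\<^esub>"
  unfolding B_group_def presented_group_def using emb_cls[of "[]"] by simp

text \<open>The partial right action of signed words on the monoid. The domain of a word depends on
  the word and not only on its class in the group, but by common left multiples it meets every
  nonempty left ideal; this is what makes the comparison in \<open>acts_gcong\<close> transitive.\<close>

fun acts :: "(bool \<times> letter) list \<Rightarrow> bmon \<Rightarrow> bmon \<Rightarrow> bool"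
  where
    "acts [] p q \<longleftrightarrow> p = q"
  | "acts ((True, s) # w) p q \<longleftrightarrow> acts w (p * gen (lower s)) q"
  | "acts ((False, s) # w) p q \<longleftrightarrow> (\<exists>r. p = r * gen (lower s) \<and> acts w r q)"

lemma acts_append: "acts (u @ v) p q \<longleftrightarrow> (\<exists>r. acts u p r \<and> acts v r q)"
  by (induction u p q rule: acts.induct) auto

lemma acts_unique: "acts w p q \<Longrightarrow> acts w p q' \<Longrightarrow> q = q'"
  by (induction w p q rule: acts.induct) (auto dest: right_cancel_gen)

lemma acts_mult: "acts w p q \<Longrightarrow> acts w (c * p) (c * q)"
proof (induction w p q rule: acts.induct)
  case (3 s w p q)
  then obtain r where r: "p = r * gen (lower s)" "acts w (c * r) (c * q)" by auto
  then have "c * p = (c * r) * gen (lower s)" by (simp add: mult.assoc)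
  then show ?case using r(2) by auto
qed (simp_all add: mult.assoc)

text \<open>An inverse letter requires divisibility by that letter, which a common left multiple of
  \<open>p\<close> and the letter provides.\<close>

lemma acts_defined: "\<exists>c q. acts w (c * p) q"
proof (induction w arbitrary: p)
  case (Cons y w)
  obtain b s where y: "y = (b, s)" by force
  show ?case
  proof (cases b)
    case True
    obtain c q where "acts w (c * (p * gen (lower s))) q" using Cons by blast
    then show ?thesis unfolding y using True by (auto simp: mult.assoc)
  next
    case False
    obtain u v where uv: "u * p = v * gen (lower s)" using common_multiple by blast
    obtain c q where "acts w (c * v) q" using Cons by blast
    then have "acts (y # w) (c * v * gen (lower s)) q" unfolding y using False by auto
    moreover have "c * v * gen (lower s) = (c * u) * p" using uv by (simp add: mult.assoc)
    ultimately show ?thesis by metis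
  qed
qed (metis acts.simps(1))

lemma acts_pos_word: "acts (pos_word w) p q \<longleftrightarrow> q = p * cls (map lower w)"
proof (induction w arbitrary: p)
  case (Cons s w)
  then show ?case using cls_Cons[of "lower s" "map lower w"] by (simp add: mult.assoc)
qed auto

lemma acts_gcong:
  "(w, w') \<in> gcong \<Longrightarrow> acts w p q \<Longrightarrow> acts w' p q' \<Longrightarrow> q = q'"
proof (induction arbitrary: p q q' rule: presented_cong.induct)
  case (refl w)
  then show ?case using acts_unique by blast
next
  case (step l r u v)
  have base: "b = c" if "acts l a b" "acts r a c" for a b c
    using step.hyps(1) unfolding group_relations_def
  proof (elim UnE)
    assume "(l, r) \<in> {(pos_word l, pos_word r) | l r. (l, r) \<in> R_bullet}"
    then show ?thesis using that lower_R_bullet by (auto simp: acts_pos_word)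
  next
    assume "(l, r) \<in> {([(b, x), (\<not> b, x)], []) | b x. x \<in> gens}"
    then obtain b' x where "l = [(b', x), (\<not> b', x)]" "r = []" by blast
    then show ?thesis using that by (cases b') (auto dest: right_cancel_gen)
  qed
  show ?case using step.prems base acts_unique unfolding acts_append by metis
next
  case (sym v w)
  then show ?case by metis
next
  case (trans u v w)
  \<comment> \<open>The middle word may be undefined at \<open>p\<close>. At \<open>c * p\<close>
    all three words are defined, and \<open>c\<close> is finally cancelled on the left.\<close>
  obtain c m where m: "acts v (c * p) m" using acts_defined by blast
  have "c * q = m" using trans.IH(1)[OF acts_mult m] trans.prems by blast
  moreover have "m = c * q'" using trans.IH(2)[OF m acts_mult] trans.prems by blast
  ultimately show ?case using left_cancel by metis
qed

text \<open>A positive word for \<open>x\<close> acts everywhere and sends 1 to \<open>x\<close>, so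
  equality in the group forces equality of the results at 1.\<close>

lemma emb_inj: "emb x = emb y \<Longrightarrow> x = y"
proof -
  assume eq: "emb x = emb y"
  obtain u v where uv: "x = cls u" "y = cls v" by (meson cls_surj)
  have "pos_word (map raise v) \<in> gcong `` {pos_word (map raise v)}"
    by (rule presented_cong_self[OF pos_word_lists[OF map_raise_lists]])
  then have "(pos_word (map raise u), pos_word (map raise v)) \<in> gcong"
    using eq unfolding uv emb_cls by blast
  then have "1 * cls (map lower (map raise u)) = 1 * cls (map lower (map raise v))"
    using acts_gcong acts_pos_word by blast
  then show "x = y" unfolding uv by (simp only: map_lower_raise mult_1)
qed

lemma B_canon_hom: "B_canon \<in> hom B_monoid B_group"
proof (rule homI)
  fix C D assume "C \<in> carrier B_monoid"
  then obtain x where x: "C = to_monoid x" by (rule to_monoid_surj)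
  then show "B_canon C \<in> carrier B_group" using emb_closed by (simp add: emb_def)
  assume "D \<in> carrier B_monoid"
  then obtain y where y: "D = to_monoid y" by (rule to_monoid_surj)
  show "B_canon (C \<otimes>\<^bsub>B_monoid\<^esub> D) = B_canon C \<otimes>\<^bsub>B_group\<^esub> B_canon D"
    unfolding x y by (simp only: to_monoid_mult[symmetric] emb_def[symmetric] emb_mult)
qed

lemma B_canon_inj: "inj_on B_canon (carrier B_monoid)"
  by (rule inj_onI) (metis to_monoid_surj emb_def emb_inj)

lemma emb_fraction:
  assumes "z \<in> carrier B_group"
  shows "\<exists>x y. z = inv\<^bsub>B_group\<^esub> (emb x) \<otimes>\<^bsub>B_group\<^esub> emb y"
proof -
  let ?L = "lists (UNIV \<times> gens)"
  have mult: "gcong `` {u @ v} = gcong `` {u} \<otimes>\<^bsub>B_group\<^esub> gcong `` {v}" if "u \<in> ?L" "v \<in> ?L" for u v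
    unfolding B_group_def presented_group_def by (rule presented_monoid_mult[OF that, symmetric])
  have closed: "gcong `` {u} \<in> carrier B_group" if "u \<in> ?L" for u
    unfolding B_group_def presented_group_def by (rule presented_monoid_closed[OF that])
  have one: "gcong `` {[]} = \<one>\<^bsub>B_group\<^esub>"
    unfolding B_group_def presented_group_def by simp
  have pos: "gcong `` {[(True, s)]} = emb (gen (lower s))" if "s \<in> gens" for s
    using that by (simp add: emb_cls)
  have neg: "gcong `` {[(False, s)]} = inv\<^bsub>B_group\<^esub> (emb (gen (lower s)))" if s: "s \<in> gens" for s
  proof -
    have lists: "[(False, s)] \<in> ?L" "[(True, s)] \<in> ?L" using s by auto
    have "([(False, s), (True, s)], []) \<in> group_relations gens R_bullet"
      using s unfolding group_relations_def by auto
    then have "([] @ [(False, s), (True, s)] @ [], [] @ [] @ []) \<in> gcong"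
      using s by (intro presented_cong.step) auto
    then have "([(False, s)] @ [(True, s)], []) \<in> gcong" by simp
    then have "gcong `` {[(False, s)]} \<otimes>\<^bsub>B_group\<^esub> gcong `` {[(True, s)]} = \<one>\<^bsub>B_group\<^esub>"
      using mult[OF lists] presented_cong_class_eq one by metis
    then show ?thesis
      using BG.inv_equality[OF _ closed[OF lists(2)] closed[OF lists(1)]] pos[OF s] by simp
  qed
  have main: "\<exists>x y. gcong `` {w} = inv\<^bsub>B_group\<^esub> (emb x) \<otimes>\<^bsub>B_group\<^esub> emb y" if "w \<in> ?L" for w
    using that
  proof (induction w rule: rev_induct)
    case Nil
    then show ?case using one by (intro exI[of _ 1]) simp
  next
    case (snoc l w)
    obtain b s where l: "l = (b, s)" "s \<in> gens" using snoc.prems by auto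
    have w: "w \<in> ?L" "[l] \<in> ?L" using snoc.prems by auto
    obtain x y where xy: "gcong `` {w} = inv\<^bsub>B_group\<^esub> (emb x) \<otimes>\<^bsub>B_group\<^esub> emb y"
      using snoc.IH[OF w(1)] by blast
    show ?case
    proof (cases b)
      case True
      have "gcong `` {w @ [l]} = inv\<^bsub>B_group\<^esub> (emb x) \<otimes>\<^bsub>B_group\<^esub> emb (y * gen (lower s))"
        using mult[OF w] xy l True pos by (simp add: BG.m_assoc emb_mult)
      then show ?thesis by blast
    next
      case False
      let ?t = "emb (gen (lower s))"
      \<comment> \<open>In the group, \<open>u y = v t\<close> gives \<open>y t^-1 = u^-1 v\<close>,
        which restores the form of a left fraction.\<close>
      obtain u v where uv: "u * y = v * gen (lower s)" using common_multiple by blast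
      have "emb u \<otimes>\<^bsub>B_group\<^esub> emb y = emb v \<otimes>\<^bsub>B_group\<^esub> ?t"
        using uv by (simp flip: emb_mult)
      then have "emb y \<otimes>\<^bsub>B_group\<^esub> inv\<^bsub>B_group\<^esub> ?t = inv\<^bsub>B_group\<^esub> (emb u) \<otimes>\<^bsub>B_group\<^esub> emb v"
        by (metis BG.inv_closed BG.inv_solve_left BG.inv_solve_right BG.m_assoc BG.m_closed emb_closed)
      then have "gcong `` {w @ [l]} = inv\<^bsub>B_group\<^esub> (emb (u * x)) \<otimes>\<^bsub>B_group\<^esub> emb v"
        using mult[OF w] xy l False neg by (simp add: BG.m_assoc emb_mult BG.inv_mult_group)
      then show ?thesis by blast
    qed
  qed
  obtain w where "w \<in> ?L" "z = gcong `` {w}"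
    using assms unfolding B_group_def presented_group_def by (rule presented_monoid_cases)
  then show ?thesis using main by blast
qed

section \<open>Absence of torsion\<close>

lemma common_denominator:
  assumes z: "z \<in> carrier B_group"
  shows "\<exists>d. \<forall>i < (n::nat). \<exists>y. emb d \<otimes>\<^bsub>B_group\<^esub> z [^]\<^bsub>B_group\<^esub> i = emb y"
proof (induction n)
  case (Suc n)
  then obtain d where d: "\<And>i. i < n \<Longrightarrow> \<exists>y. emb d \<otimes>\<^bsub>B_group\<^esub> z [^]\<^bsub>B_group\<^esub> i = emb y" by blast
  have zn: "z [^]\<^bsub>B_group\<^esub> n \<in> carrier B_group" using z by simp
  obtain a b where ab: "z [^]\<^bsub>B_group\<^esub> n = inv\<^bsub>B_group\<^esub> (emb a) \<otimes>\<^bsub>B_group\<^esub> emb b"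
    using emb_fraction[OF zn] by blast
  \<comment> \<open>The new denominator is a common left multiple of the old one and of the
    denominator \<open>a\<close> of the next power.\<close>
  obtain u v where uv: "u * d = v * a" using common_multiple by blast
  have "\<exists>y. emb (u * d) \<otimes>\<^bsub>B_group\<^esub> z [^]\<^bsub>B_group\<^esub> i = emb y" if "i < Suc n" for i
  proof (cases "i = n")
    case True
    have "emb (u * d) \<otimes>\<^bsub>B_group\<^esub> z [^]\<^bsub>B_group\<^esub> i
      = emb v \<otimes>\<^bsub>B_group\<^esub> (emb a \<otimes>\<^bsub>B_group\<^esub> (inv\<^bsub>B_group\<^esub> (emb a) \<otimes>\<^bsub>B_group\<^esub> emb b))"
      unfolding True ab uv by (simp add: emb_mult BG.m_assoc)
    also have "\<dots> = emb (v * b)"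
      by (simp add: emb_mult BG.r_inv flip: BG.m_assoc)
    finally show ?thesis by blast
  next
    case False
    then obtain y where "emb d \<otimes>\<^bsub>B_group\<^esub> z [^]\<^bsub>B_group\<^esub> i = emb y" using d \<open>i < Suc n\<close> by force
    then have "emb (u * d) \<otimes>\<^bsub>B_group\<^esub> z [^]\<^bsub>B_group\<^esub> i = emb (u * y)"
      using z by (simp add: emb_mult BG.m_assoc)
    then show ?thesis by blast
  qed
  then show ?case by blast
qed simp

lemma torsion_free_B_group: "torsion_free B_group"
  unfolding torsion_free_def
proof (intro ballI allI impI)
  fix z and n :: nat
  assume z: "z \<in> carrier B_group" and n: "n > 0" and zn: "z [^]\<^bsub>B_group\<^esub> n = \<one>\<^bsub>B_group\<^esub>"
  have period: "z [^]\<^bsub>B_group\<^esub> (i + n) = z [^]\<^bsub>B_group\<^esub> i" for i :: nat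
    using z zn by (simp flip: BG.nat_pow_mult)
  obtain d where "\<forall>i < n. \<exists>y. emb d \<otimes>\<^bsub>B_group\<^esub> z [^]\<^bsub>B_group\<^esub> i = emb y"
    using common_denominator[OF z] by blast
  moreover have "\<exists>j < n. z [^]\<^bsub>B_group\<^esub> i = z [^]\<^bsub>B_group\<^esub> j" for i :: nat
  proof (induction i rule: less_induct)
    case (less i)
    show ?case
    proof (cases "i < n")
      case False
      then show ?thesis using less[of "i - n"] period[of "i - n"] n by auto
    qed blast
  qed
  ultimately have "\<forall>i::nat. \<exists>y. emb d \<otimes>\<^bsub>B_group\<^esub> z [^]\<^bsub>B_group\<^esub> i = emb y" by metis
  then obtain y where y: "\<And>i::nat. emb d \<otimes>\<^bsub>B_group\<^esub> z [^]\<^bsub>B_group\<^esub> i = emb (y i)" by metis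
  have y_period: "y (i + n) = y i" for i
    by (rule emb_inj) (simp add: period flip: y)
  have y_Suc: "emb (u * y i) \<otimes>\<^bsub>B_group\<^esub> z = emb (u * y (Suc i))" for u i
    using z by (simp add: emb_mult BG.m_assoc flip: y)
  \<comment> \<open>\<open>m\<close> is the left lcm of one full period of the
    \<open>y i\<close>.\<close>
  obtain m where m: "\<And>h. (\<forall>x \<in> y ` {..<n}. rdiv x h) \<longleftrightarrow> rdiv m h"
    using finite_lcm[of "y ` {..<n}"] by blast
  have ym: "rdiv (y i) m" for i
  proof (induction i rule: less_induct)
    case (less i)
    show ?case
    proof (cases "i < n")
      case True
      then show ?thesis using m[of m] by simp
    next
      case False
      then show ?thesis using less[of "i - n"] y_period[of "i - n"] n by auto
    qed
  qed
  then obtain u where u: "\<And>i. m = u i * y i" unfolding rdiv_def by metis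
  \<comment> \<open>The product of \<open>m\<close> and \<open>z\<close> is computed from the
    factorization of \<open>m\<close> through \<open>y 0\<close>; the other factorizations
    \<open>u i * y i\<close> yield the same element.\<close>
  define m' where "m' = u 0 * y (Suc 0)"
  have m': "emb m \<otimes>\<^bsub>B_group\<^esub> z = emb m'"
    unfolding m'_def using y_Suc[of "u 0" 0] u[of 0] by simp
  have "rdiv (y i) m'" for i
  proof -
    \<comment> \<open>\<open>j\<close> is the predecessor of \<open>i\<close> modulo the period, so
      that \<open>i = 0\<close> is covered too.\<close>
    obtain j where j: "i + n = Suc j" using n by (cases "i + n") auto
    have "emb m' = emb (u j * y (Suc j))" using m' y_Suc[of "u j" j] u[of j] by simp
    then have "m' = u j * y i" using emb_inj y_period[of i] j by simp
    then show ?thesis by simp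
  qed
  then obtain v where v: "m' = v * m" using m[of m'] unfolding rdiv_def by blast
  have pow: "emb m \<otimes>\<^bsub>B_group\<^esub> z [^]\<^bsub>B_group\<^esub> k = emb (v ^ k * m)" for k :: nat
  proof (induction k)
    case (Suc k)
    have "emb m \<otimes>\<^bsub>B_group\<^esub> z [^]\<^bsub>B_group\<^esub> Suc k = emb (v ^ k * m) \<otimes>\<^bsub>B_group\<^esub> z"
      using Suc z by (simp flip: BG.m_assoc)
    also have "\<dots> = emb (v ^ k) \<otimes>\<^bsub>B_group\<^esub> (emb m \<otimes>\<^bsub>B_group\<^esub> z)"
      using z by (simp add: emb_mult BG.m_assoc)
    also have "\<dots> = emb (v ^ Suc k * m)"
      unfolding m' v by (simp add: power_Suc2 mult.assoc del: power_Suc flip: emb_mult)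
    finally show ?case .
  qed simp
  have "1 * m = v ^ n * m" using pow[of n] zn by (intro emb_inj) simp
  then have "v ^ n = 1" using right_cancel by metis
  then have "v = 1" using power_eq_1_imp n by blast
  then have "emb m \<otimes>\<^bsub>B_group\<^esub> z = emb m \<otimes>\<^bsub>B_group\<^esub> \<one>\<^bsub>B_group\<^esub>" using m' v by simp
  then show "z = \<one>\<^bsub>B_group\<^esub>" using z by simp
qed

section \<open>Factors in the braid monoid and in Thompson's monoid\<close>

lemma generated_submonoid_one: "\<one>\<^bsub>M\<^esub> \<in> generated_submonoid M S"
  unfolding generated_submonoid_def by (auto intro: submonoid.one_closed)

lemma generated_submonoid_mult:
  "x \<in> generated_submonoid M S \<Longrightarrow> y \<in> generated_submonoid M S \<Longrightarrow>
    x \<otimes>\<^bsub>M\<^esub> y \<in> generated_submonoid M S"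
  unfolding generated_submonoid_def by (auto intro: submonoid.m_closed)

lemma generated_submonoid_gen: "x \<in> S \<Longrightarrow> x \<in> generated_submonoid M S"
  unfolding generated_submonoid_def by blast

lemma to_monoid_braid: "b \<in> braids UNIV \<Longrightarrow> to_monoid b \<in> braid_submonoid"
proof -
  have "to_monoid (sgs u) \<in> braid_submonoid" for u
  proof (induction u)
    case Nil
    then show ?case
      unfolding braid_submonoid_def by (simp add: to_monoid_one generated_submonoid_one)
  next
    case (Cons k u)
    have "to_monoid (sg k) \<in> braid_submonoid"
      unfolding braid_submonoid_def
      by (rule generated_submonoid_gen) (auto simp: to_monoid_cls intro!: exI[of _ "Suc k"])
    then show ?case
      using Cons unfolding sgs_Cons to_monoid_mult braid_submonoid_def
      by (rule generated_submonoid_mult)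
  qed
  then show "b \<in> braids UNIV \<Longrightarrow> to_monoid b \<in> braid_submonoid"
    unfolding braids_def by blast
qed

lemma to_monoid_als: "to_monoid (als f) \<in> thompson_submonoid"
proof (induction f)
  case Nil
  then show ?case
    unfolding thompson_submonoid_def by (simp add: to_monoid_one generated_submonoid_one)
next
  case (Cons i f)
  have "to_monoid (al i) \<in> thompson_submonoid"
    unfolding thompson_submonoid_def
    by (rule generated_submonoid_gen) (auto simp: to_monoid_cls intro!: exI[of _ "Suc i"])
  then show ?case
    using Cons unfolding als_Cons to_monoid_mult thompson_submonoid_def
    by (rule generated_submonoid_mult)
qed

theorem proposition2p20:
  shows "(B_canon \<in> hom B_monoid B_group \<and> inj_on B_canon (carrier B_monoid)) \<and>
    (\<forall>z \<in> carrier B_group. \<exists>x \<in> carrier B_monoid. \<exists>y \<in> carrier B_monoid.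
      z = inv\<^bsub>B_group\<^esub> (B_canon x) \<otimes>\<^bsub>B_group\<^esub> B_canon y) \<and>
    (\<forall>z \<in> carrier B_group.
      \<exists>\<beta> \<in> braid_submonoid. \<exists>\<gamma> \<in> braid_submonoid.
      \<exists>f \<in> thompson_submonoid. \<exists>g \<in> thompson_submonoid.
      z = inv\<^bsub>B_group\<^esub> (B_canon f) \<otimes>\<^bsub>B_group\<^esub> inv\<^bsub>B_group\<^esub> (B_canon \<beta>)
        \<otimes>\<^bsub>B_group\<^esub> B_canon \<gamma> \<otimes>\<^bsub>B_group\<^esub> B_canon g) \<and>
    torsion_free B_group"
proof (intro conjI ballI)
  show "B_canon \<in> hom B_monoid B_group" by (rule B_canon_hom)
  show "inj_on B_canon (carrier B_monoid)" by (rule B_canon_inj)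
  show "torsion_free B_group" by (rule torsion_free_B_group)
next
  fix z assume "z \<in> carrier B_group"
  then show "\<exists>x \<in> carrier B_monoid. \<exists>y \<in> carrier B_monoid.
      z = inv\<^bsub>B_group\<^esub> (B_canon x) \<otimes>\<^bsub>B_group\<^esub> B_canon y"
    using emb_fraction unfolding emb_def by (meson to_monoid_closed)
next
  fix z assume "z \<in> carrier B_group"
  then obtain x y where xy: "z = inv\<^bsub>B_group\<^esub> (emb x) \<otimes>\<^bsub>B_group\<^esub> emb y"
    using emb_fraction by blast
  \<comment> \<open>It suffices to factor numerator and denominator: inverting
    \<open>b * als f\<close> reverses it, so the inverse of \<open>als f\<close> comes
    first.\<close>
  obtain b f where b: "b \<in> braids UNIV" "x = b * als f" using braid_als_decomposition by blast
  obtain c g where c: "c \<in> braids UNIV" "y = c * als g" using braid_als_decomposition by blast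
  have "z = inv\<^bsub>B_group\<^esub> (emb (als f)) \<otimes>\<^bsub>B_group\<^esub> inv\<^bsub>B_group\<^esub> (emb b)
      \<otimes>\<^bsub>B_group\<^esub> emb c \<otimes>\<^bsub>B_group\<^esub> emb (als g)"
    unfolding xy b(2) c(2) by (simp add: emb_mult BG.inv_mult_group BG.m_assoc)
  then show "\<exists>\<beta> \<in> braid_submonoid. \<exists>\<gamma> \<in> braid_submonoid.
      \<exists>f \<in> thompson_submonoid. \<exists>g \<in> thompson_submonoid.
      z = inv\<^bsub>B_group\<^esub> (B_canon f) \<otimes>\<^bsub>B_group\<^esub> inv\<^bsub>B_group\<^esub> (B_canon \<beta>)
        \<otimes>\<^bsub>B_group\<^esub> B_canon \<gamma> \<otimes>\<^bsub>B_group\<^esub> B_canon g"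
    using to_monoid_braid[OF b(1)] to_monoid_braid[OF c(1)] to_monoid_als
    unfolding emb_def by blast
qed

end
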